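(* Let $X$ be a tropical abelian variety of dimension $n\ge 1$ and let $L$ be a positive tropical line bundle on $X$. Let $d$ be an integer with $d\geq\max\{3,2(n-1)!\}$. Then the $d$-th multiple $dL$ admits a faithful embedding of $X$.
   Context: $\mathbb T=\mathbb R\cup\{+\infty\}$. Let $M$ be a free $\mathbb Z$-module of rank $n$, $N=\operatorname{Hom}(M,\mathbb Z)$, $N_{\mathbb R}=\operatorname{Hom}(M,\mathbb R)$, $\langle\cdot,\cdot\rangle:M\times N_{\mathbb R}\to\mathbb R$ the pairing, and $M'\subset N_{\mathbb R}$ a full lattice. $X=N_{\mathbb R}/M'$ is a real torus (with integral structure $N$) of dimension $n$; $\pi:N_{\mathbb R}\to X$ is the projection. A rational polyhedral decomposition of $N_{\mathbb R}$ is a locally finite polyhedral complex covering $N_{\mathbb R}$ with cells cut out by finitely many inequalities $\langle u,x\rangle\ge b$, $u\in M$, $b\in\mathbb R$. A function $N_{\mathbb R}\to\mathbb R$ is piecewise $\mathbb Z$-affine if on each cell of some such decomposition it equals $x\mapsto\langle u,x\rangle+b$ with $u\in M,b\in\mathbb R$. A regular function on $N_{\mathbb R}$ is either the constant $+\infty$ or a concave piecewise $\mathbb Z$-affine real function. A tropical descent datum is a pair $(\lambda,\gamma)$ with $\lambda:M'\to M$ a homomorphism and $\gamma:M'\to\mathbb R$ a map such that $\gamma(u_1'+u_2')-\gamma(u_1')-\gamma(u_2')=\langle\lambda(u_2'),u_1'\rangle$ for all $u_1',u_2'\in M'$. A tropical theta function for $(\lambda,\gamma)$ is a regular function $\vartheta$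 on $N_{\mathbb R}$ with $\vartheta(x+u')=\vartheta(x)-\langle\lambda(u'),x\rangle-\gamma(u')$ for all $x\in N_{\mathbb R},u'\in M'$. The tropical line bundle $L(\lambda,\gamma)$ on $X$ is the quotient of $N_{\mathbb R}\times\mathbb T$ by the $M'$-action $u'\cdot(x,t)=(x+u',t-\langle\lambda(u'),x\rangle-\gamma(u'))$; every tropical line bundle on $X$ is isomorphic to some $L(\lambda,\gamma)$, with $\lambda$ uniquely determined, and its regular global sections $H^0(X,L(\lambda,\gamma))$ are identified (by pullback along $\pi$) with the tropical theta functions for $(\lambda,\gamma)$. One has $dL(\lambda,\gamma)=L(d\lambda,d\gamma)$. For a homomorphism $\lambda:M'\to M$ such that $\langle\lambda(u_1'),u_2'\rangle=\langle\lambda(u_2'),u_1'\rangle$ for all $u_1',u_2'\in M'$ (this holds automatically when $\lambda$ is part of a tropical descent datum $(\lambda,\gamma)$), let $Q$ be the symmetric $\mathbb R$-bilinear form on $N_{\mathbb R}=M'_{\mathbb R}$ with $Q(u_1',u_2')=\langle\lambda(u_1'),u_2'\rangle$ for $u_1',u_2'\in M'$. Such a $\lambda$ is a polarization on $X$ if $Q$ is positive-definite; $L(\lambda,\gamma)$ is positive if $\lambda$ is a polarization; $X$ is a tropical abelian variety if it has a polarization. For $s_0,\dots,s_m\in H^0(X,L)\setminus\{+\infty\}$, the map $\varphi_{s_0,\dots,s_m}:X\to\mathbb R^{m+1}/\mathbb R(1,\dots,1)\subset\mathbb{TP}^m$, where $\mathbb{TP}^m=(\mathbb T^{m+1}\setminus\{(+\infty,\dots,+\infty)\})/\!\sim$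 is the tropical projective space ($\sim$ being simultaneous addition of a real constant to all coordinates), is $x\mapsto(s_0(\tilde x):\cdots:s_m(\tilde x))$ for any lift $\tilde x\in N_{\mathbb R}$ of $x$; the target is identified with $\mathbb R^m$ via $(a_0:\cdots:a_m)\mapsto(a_i-a_0)_{i\ge1}$. A map $\varphi:X\to\mathbb R^m$ is unimodular if there is a rational polyhedral decomposition of $N_{\mathbb R}$ on each cell of which $\varphi\circ\pi$ agrees with an affine map whose linear part is the extension of an injective homomorphism $N\to\mathbb Z^m$ with torsion-free cokernel. It is a faithful embedding if it is unimodular and a homeomorphism onto its image. $L$ admits a faithful embedding if some $s_0,\dots,s_m\in H^0(X,L)\setminus\{+\infty\}$ give a faithful embedding $\varphi_{s_0,\dots,s_m}$. *)

theory Defs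
  imports "HOL-Analysis.Analysis"
begin

text \<open>
  Throughout, \<open>M\<close> is (all of) the type \<open>'m\<close> and \<open>N\<^sub>\<real> = Hom(M, \<real>)\<close> is modelled by a type
  \<open>'v\<close> that is identified with the additive maps from \<open>'m\<close> to \<open>real\<close> by a pairing
  (see \<open>real_dual_pairing\<close>). Only the vector space structure and the topology of \<open>'v\<close> are used,
  not its inner product. Values in \<open>\<real> \<union> {+\<infinity>}\<close> live in \<^typ>\<open>ereal\<close>; no regular function
  takes the value \<open>-\<infinity>\<close>.
\<close>

definition free_int_module :: "(int \<Rightarrow> 'm::ab_group_add \<Rightarrow> 'm) \<Rightarrow> nat \<Rightarrow> bool" where
  "free_int_module smul n \<longleftrightarrow> module smul \<and>
     (\<exists>B. finite B \<and> card B = n \<and> \<not> module.dependent smul B \<and> module.span smul B = UNIV)"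

definition real_dual_pairing :: "('m::ab_group_add \<Rightarrow> 'v::euclidean_space \<Rightarrow> real) \<Rightarrow> bool" where
  "real_dual_pairing pair \<longleftrightarrow>
     (\<forall>u. linear (pair u)) \<and> bij_betw (\<lambda>x u. pair u x) UNIV {f. Modules.additive f}"

text \<open>The integral structure \<open>N = Hom(M, \<int>)\<close> inside \<open>N\<^sub>\<real>\<close>:\<close>

definition int_dual :: "('m \<Rightarrow> 'v \<Rightarrow> real) \<Rightarrow> 'v set" where
  "int_dual pair = {x. \<forall>u. pair u x \<in> \<int>}"

definition full_lattice :: "'v::euclidean_space set \<Rightarrow> bool" where
  "full_lattice M' \<longleftrightarrow>
     (\<exists>B. independent B \<and> span B = UNIV \<and> M' = {\<Sum>b\<in>B. of_int (c b) *\<^sub>R b | c :: 'v \<Rightarrow> int. True})"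

text \<open>The points of the torus \<open>X = N\<^sub>\<real>/M'\<close> are the cosets of \<open>M'\<close>, and \<open>torus_proj M'\<close> is \<open>\<pi>\<close>.\<close>

definition torus_proj :: "'v::euclidean_space set \<Rightarrow> 'v \<Rightarrow> 'v set" where
  "torus_proj M' x = (\<lambda>u'. x + u') ` M'"

definition torus :: "'v::euclidean_space set \<Rightarrow> 'v set topology" where
  "torus M' = topology (\<lambda>U. U \<subseteq> range (torus_proj M') \<and> open (torus_proj M' -` U))"

lemma openin_torus:
  "openin (torus M') U \<longleftrightarrow> U \<subseteq> range (torus_proj M') \<and> open (torus_proj M' -` U)"
proof -
  have "istopology (\<lambda>U. U \<subseteq> range (torus_proj M') \<and> open (torus_proj M' -` U))"
    unfolding istopology_def
  proof (intro conjI allI impI)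
    fix S T
    assume "S \<subseteq> range (torus_proj M') \<and> open (torus_proj M' -` S)"
      and "T \<subseteq> range (torus_proj M') \<and> open (torus_proj M' -` T)"
    then show "S \<inter> T \<subseteq> range (torus_proj M')" "open (torus_proj M' -` (S \<inter> T))"
      by (blast, simp add: open_Int)
  next
    fix K
    assume K: "\<forall>S\<in>K. S \<subseteq> range (torus_proj M') \<and> open (torus_proj M' -` S)"
    then show "\<Union>K \<subseteq> range (torus_proj M')"
      by blast
    show "open (torus_proj M' -` \<Union>K)"
      unfolding vimage_Union using K by (intro open_UN) blast
  qed
  then show ?thesis
    by (simp add: torus_def topology_inverse')
qed

lemma topspace_torus: "topspace (torus M') = range (torus_proj M')"
proof (rule antisym)
  show "topspace (torus M') \<subseteq> range (torus_proj M')"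
    unfolding topspace_def openin_torus by blast
  have "torus_proj M' -` range (torus_proj M') = UNIV"
    by blast
  then have "openin (torus M') (range (torus_proj M'))"
    by (simp add: openin_torus)
  then show "range (torus_proj M') \<subseteq> topspace (torus M')"
    by (rule openin_subset)
qed

lemma quotient_map_torus_proj: "quotient_map euclidean (torus M') (torus_proj M')"
  by (simp add: quotient_map_def topspace_torus openin_torus vimage_def)


subsection \<open>Regular functions\<close>

definition rational_polyhedron :: "('m \<Rightarrow> 'v \<Rightarrow> real) \<Rightarrow> 'v set \<Rightarrow> bool" where
  "rational_polyhedron pair C \<longleftrightarrow>
     (\<exists>I :: ('m \<times> real) set. finite I \<and> C = {x. \<forall>(u, b)\<in>I. pair u x \<ge> b})"

text \<open>
  Cells are required to be nonempty, so closure under faces concerns nonempty faces only; two cells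
  may still be disjoint because \<open>{}\<close> is a face in the sense of \<open>face_of\<close>.
\<close>

definition rational_polyhedral_decomposition ::
    "('m \<Rightarrow> 'v::euclidean_space \<Rightarrow> real) \<Rightarrow> 'v set set \<Rightarrow> bool" where
  "rational_polyhedral_decomposition pair \<C> \<longleftrightarrow>
     (\<forall>C\<in>\<C>. C \<noteq> {} \<and> rational_polyhedron pair C) \<and>
     (\<forall>C\<in>\<C>. \<forall>F. F face_of C \<and> F \<noteq> {} \<longrightarrow> F \<in> \<C>) \<and>
     (\<forall>C\<in>\<C>. \<forall>D\<in>\<C>. (C \<inter> D) face_of C \<and> (C \<inter> D) face_of D) \<and>
     locally_finite_in euclidean \<C> \<and>
     \<Union>\<C> = UNIV"

definition piecewise_int_affine ::
    "('m \<Rightarrow> 'v::euclidean_space \<Rightarrow> real) \<Rightarrow> ('v \<Rightarrow> real) \<Rightarrow> bool" where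
  "piecewise_int_affine pair f \<longleftrightarrow>
     (\<exists>\<C>. rational_polyhedral_decomposition pair \<C> \<and>
       (\<forall>C\<in>\<C>. \<exists>u b. \<forall>x\<in>C. f x = pair u x + b))"

definition regular_function ::
    "('m \<Rightarrow> 'v::euclidean_space \<Rightarrow> real) \<Rightarrow> ('v \<Rightarrow> ereal) \<Rightarrow> bool" where
  "regular_function pair \<theta> \<longleftrightarrow> \<theta> = (\<lambda>_. \<infinity>) \<or>
     (\<exists>f. \<theta> = (\<lambda>x. ereal (f x)) \<and> concave_on UNIV f \<and> piecewise_int_affine pair f)"


subsection \<open>Descent data, theta functions, polarizations\<close>

text \<open>
  A homomorphism \<open>\<lambda> : M' \<rightarrow> M\<close> and a map \<open>\<gamma> : M' \<rightarrow> \<real>\<close> are given by functions on all of \<open>'v\<close>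
  whose values off \<open>M'\<close> are never used. The line bundle \<open>L(\<lambda>, \<gamma>)\<close> is represented by its
  descent datum.
\<close>

definition lattice_hom :: "'v::euclidean_space set \<Rightarrow> ('v \<Rightarrow> 'm::ab_group_add) \<Rightarrow> bool" where
  "lattice_hom M' lam \<longleftrightarrow> (\<forall>u\<in>M'. \<forall>v\<in>M'. lam (u + v) = lam u + lam v)"

definition tropical_descent_datum ::
    "('m::ab_group_add \<Rightarrow> 'v::euclidean_space \<Rightarrow> real) \<Rightarrow> 'v set \<Rightarrow> ('v \<Rightarrow> 'm) \<Rightarrow> ('v \<Rightarrow> real) \<Rightarrow> bool" where
  "tropical_descent_datum pair M' lam gam \<longleftrightarrow> lattice_hom M' lam \<and>
     (\<forall>u1\<in>M'. \<forall>u2\<in>M'. gam (u1 + u2) - gam u1 - gam u2 = pair (lam u2) u1)"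

text \<open>The regular global sections \<open>H\<^sup>0(X, L(\<lambda>, \<gamma>))\<close>, pulled back to \<open>N\<^sub>\<real>\<close>:\<close>

definition theta_functions ::
    "('m::ab_group_add \<Rightarrow> 'v::euclidean_space \<Rightarrow> real) \<Rightarrow> 'v set \<Rightarrow> ('v \<Rightarrow> 'm) \<Rightarrow> ('v \<Rightarrow> real)
      \<Rightarrow> ('v \<Rightarrow> ereal) set" where
  "theta_functions pair M' lam gam = {\<theta>. regular_function pair \<theta> \<and>
     (\<forall>x. \<forall>u\<in>M'. \<theta> (x + u) = \<theta> x - ereal (pair (lam u) x) - ereal (gam u))}"

definition polarization ::
    "('m::ab_group_add \<Rightarrow> 'v::euclidean_space \<Rightarrow> real) \<Rightarrow> 'v set \<Rightarrow> ('v \<Rightarrow> 'm) \<Rightarrow> bool" where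
  "polarization pair M' lam \<longleftrightarrow> lattice_hom M' lam \<and>
     (\<forall>u1\<in>M'. \<forall>u2\<in>M'. pair (lam u1) u2 = pair (lam u2) u1) \<and>
     (\<exists>Q. bilinear Q \<and> (\<forall>x y. Q x y = Q y x) \<and>
        (\<forall>u1\<in>M'. \<forall>u2\<in>M'. Q u1 u2 = pair (lam u1) u2) \<and>
        (\<forall>x. x \<noteq> 0 \<longrightarrow> Q x x > 0))"

definition tropical_abelian_variety ::
    "('m::ab_group_add \<Rightarrow> 'v::euclidean_space \<Rightarrow> real) \<Rightarrow> 'v set \<Rightarrow> bool" where
  "tropical_abelian_variety pair M' \<longleftrightarrow> full_lattice M' \<and> (\<exists>lam. polarization pair M' lam)"

definition positive_line_bundle ::
    "('m::ab_group_add \<Rightarrow> 'v::euclidean_space \<Rightarrow> real) \<Rightarrow> 'v set \<Rightarrow> ('v \<Rightarrow> 'm) \<Rightarrow> ('v \<Rightarrow> real) \<Rightarrow> bool" where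
  "positive_line_bundle pair M' lam gam \<longleftrightarrow>
     tropical_descent_datum pair M' lam gam \<and> polarization pair M' lam"


subsection \<open>Faithful embeddings\<close>

text \<open>
  \<open>\<real>\<^sup>m\<close> is \<open>Euclidean_space m\<close>, i.e. the sequences vanishing at all indices \<open>\<ge> m\<close>, so
  \<open>(a\<^sub>0 : \<dots> : a\<^sub>m)\<close> becomes \<open>i \<mapsto> a\<^bsub>i+1\<^esub> - a\<^sub>0\<close> for \<open>i < m\<close>. For theta functions with the same
  descent datum the choice of the lift is irrelevant, see \<open>theta_map_torus_proj\<close> below.
\<close>

definition theta_map ::
    "'v::euclidean_space set \<Rightarrow> nat \<Rightarrow> (nat \<Rightarrow> 'v \<Rightarrow> ereal) \<Rightarrow> 'v set \<Rightarrow> nat \<Rightarrow> real" where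
  "theta_map M' m s c = (let x = (SOME x. torus_proj M' x = c) in
     (\<lambda>i. if i < m then real_of_ereal (s (Suc i) x) - real_of_ereal (s 0 x) else 0))"

lemma theta_map_torus_proj:
  assumes lattice: "full_lattice M'"
    and theta: "\<forall>i\<le>m. s i \<in> theta_functions pair M' lam gam - {\<lambda>_. \<infinity>}"
  shows "theta_map M' m s (torus_proj M' x) =
    (\<lambda>i. if i < m then real_of_ereal (s (Suc i) x) - real_of_ereal (s 0 x) else 0)"
proof -
  define y where "y = (SOME y. torus_proj M' y = torus_proj M' x)"
  have y: "torus_proj M' y = torus_proj M' x"
    unfolding y_def by (rule someI) simp
  obtain B :: "'a set" where B: "M' = {\<Sum>b\<in>B. of_int (c b) *\<^sub>R b | c :: 'a \<Rightarrow> int. True}"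
    using lattice unfolding full_lattice_def by blast
  have "0 \<in> M'"
    unfolding B by (rule CollectI, rule exI[of _ "\<lambda>_. 0"]) simp
  then have "y \<in> torus_proj M' y"
    unfolding torus_proj_def by force
  then have "y \<in> torus_proj M' x"
    by (simp only: y)
  then obtain u where u: "u \<in> M'" "y = x + u"
    unfolding torus_proj_def by auto
  have real: "real_of_ereal (s i y) = real_of_ereal (s i x) - pair (lam u) x - gam u" if "i \<le> m" for i
  proof -
    have "s i y = s i x - ereal (pair (lam u) x) - ereal (gam u)"
      and "regular_function pair (s i)" and "s i \<noteq> (\<lambda>_. \<infinity>)"
      using theta that u by (auto simp: theta_functions_def)
    then show ?thesis
      by (auto simp: regular_function_def)
  qed
  show ?thesis
    unfolding theta_map_def Let_def y_def[symmetric] by (auto simp: real)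
qed

definition int_vectors :: "nat \<Rightarrow> (nat \<Rightarrow> int) set" where
  "int_vectors m = {y. \<forall>i\<ge>m. y i = 0}"

text \<open>Injective homomorphisms \<open>N \<rightarrow> \<int>\<^sup>m\<close> such that \<open>\<int>\<^sup>m / h(N)\<close> is torsion-free:\<close>

definition unimodular_hom ::
    "('m \<Rightarrow> 'v::euclidean_space \<Rightarrow> real) \<Rightarrow> nat \<Rightarrow> ('v \<Rightarrow> nat \<Rightarrow> int) \<Rightarrow> bool" where
  "unimodular_hom pair m h \<longleftrightarrow>
     h ` int_dual pair \<subseteq> int_vectors m \<and>
     (\<forall>x\<in>int_dual pair. \<forall>y\<in>int_dual pair. \<forall>i. h (x + y) i = h x i + h y i) \<and>
     inj_on h (int_dual pair) \<and>
     (\<forall>y\<in>int_vectors m. \<forall>k :: int. k \<noteq> 0 \<and> (\<lambda>i. k * y i) \<in> h ` int_dual pair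
        \<longrightarrow> y \<in> h ` int_dual pair)"

definition unimodular_map ::
    "('m \<Rightarrow> 'v::euclidean_space \<Rightarrow> real) \<Rightarrow> 'v set \<Rightarrow> nat \<Rightarrow> ('v set \<Rightarrow> nat \<Rightarrow> real) \<Rightarrow> bool" where
  "unimodular_map pair M' m \<phi> \<longleftrightarrow>
     (\<exists>\<C>. rational_polyhedral_decomposition pair \<C> \<and>
       (\<forall>C\<in>\<C>. \<exists>h F b. unimodular_hom pair m h \<and>
          (\<forall>i<m. linear (\<lambda>x. F x i) \<and> (\<forall>x\<in>int_dual pair. F x i = of_int (h x i))) \<and>
          (\<forall>x\<in>C. \<forall>i<m. \<phi> (torus_proj M' x) i = F x i + b i)))"

definition faithful_embedding ::
    "('m \<Rightarrow> 'v::euclidean_space \<Rightarrow> real) \<Rightarrow> 'v set \<Rightarrow> nat \<Rightarrow> ('v set \<Rightarrow> nat \<Rightarrow> real) \<Rightarrow> bool" where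
  "faithful_embedding pair M' m \<phi> \<longleftrightarrow>
     unimodular_map pair M' m \<phi> \<and> embedding_map (torus M') (Euclidean_space m) \<phi>"

definition admits_faithful_embedding ::
    "('m::ab_group_add \<Rightarrow> 'v::euclidean_space \<Rightarrow> real) \<Rightarrow> 'v set \<Rightarrow> ('v \<Rightarrow> 'm) \<Rightarrow> ('v \<Rightarrow> real) \<Rightarrow> bool" where
  "admits_faithful_embedding pair M' lam gam \<longleftrightarrow>
     (\<exists>m s. (\<forall>i\<le>m. s i \<in> theta_functions pair M' lam gam - {\<lambda>_. \<infinity>}) \<and>
        faithful_embedding pair M' m (theta_map M' m s))"

end

theory Submission
  imports Defs
begin

text \<open>
  Write \<open>q x = Q x x\<close> for the form of the polarization. Completing the square turns the theta
  functions of \<open>dL\<close> with Fourier exponents in one coset of \<open>d \<lambda>(M')\<close> into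
  \<open>x \<mapsto> d/2 (dist\<^sup>2(x + c, p + M') - q (x + c))\<close> plus a constant, where \<open>dist\<close> is the distance
  defined by \<open>q\<close> and \<open>p\<close> lies in the lattice
  \<open>P \<supseteq> (1/d) M'\<close> that corresponds to \<open>M\<close> under \<open>d Q\<close>; the slopes at \<open>x\<close> are given by the points
  of \<open>p + M'\<close> nearest to \<open>x + c\<close>.
  Let \<open>p\<close> be the point of \<open>P\<close> nearest to \<open>x + c\<close>, and let \<open>W\<close>, \<open>V\<close> be the Voronoi cells of \<open>P\<close> and
  \<open>M'\<close>, so \<open>d W \<subseteq> V\<close>. The vectors \<open>s\<close> in \<open>P \<inter> 2W\<close> generate \<open>P\<close>, and \<open>x + c - p - s\<close> lies in
  \<open>3W \<subseteq> V\<close> as \<open>d \<ge> 3\<close>. So every \<open>p + s\<close> is nearest to \<open>x + c\<close> in its own coset, and the differences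
  of the slopes at \<open>x\<close> generate \<open>M\<close>. If \<open>x\<close> and \<open>y\<close> have the same image, the coset distances from
  the two points differ by a constant, hence \<open>p\<close> is also nearest to \<open>y + c\<close> after a translation of
  \<open>y\<close> by \<open>M'\<close>; comparing the distances to all \<open>p + s\<close> gives \<open>x = y\<close>.
\<close>

text \<open>\<open>slope_P\<close> and \<open>slope_surj\<close> match the elements of
  \<open>M\<close> with the forms \<open>d * Q p\<close>, \<open>p\<close> in \<open>P\<close>.
  Discreteness enters as finiteness of the sublevel sets of \<open>Q p p\<close>, and
  \<open>c\<close> is the translation that absorbs the linear part of the descent datum.\<close>

locale polarized_lattice =
  fixes pair :: "'m::ab_group_add \<Rightarrow> 'v::euclidean_space \<Rightarrow> real"
    and M' P :: "'v set" and Q :: "'v \<Rightarrow> 'v \<Rightarrow> real" and c :: 'v and d :: real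
  assumes bilinear_Q: "bilinear Q"
    and Q_commute: "Q x y = Q y x"
    and Q_pos: "x \<noteq> 0 \<Longrightarrow> Q x x > 0"
    and d_ge_3: "d \<ge> 3"
    and zero_M': "0 \<in> M'"
    and diff_M': "u \<in> M' \<Longrightarrow> v \<in> M' \<Longrightarrow> u - v \<in> M'"
    and diff_P: "p \<in> P \<Longrightarrow> r \<in> P \<Longrightarrow> p - r \<in> P"
    and M'_subset_P: "M' \<subseteq> P"
    and divide_M': "u \<in> M' \<Longrightarrow> (1 / d) *\<^sub>R u \<in> P"
    and finite_sublevel_P: "finite {p \<in> P. Q p p \<le> K}"
    and cocompact_M': "\<exists>r. \<forall>x. \<exists>u\<in>M'. norm (x - u) \<le> r"
    and orthogonal_M': "(\<And>u. u \<in> M' \<Longrightarrow> Q u z = 0) \<Longrightarrow> z = 0"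
    and slope_M': "u \<in> M' \<Longrightarrow> \<exists>w. \<forall>x. pair w x = Q u x"
    and slope_P: "p \<in> P \<Longrightarrow> \<exists>w. \<forall>x. pair w x = d * Q p x"
    and slope_surj: "\<exists>p\<in>P. \<forall>x. pair w x = d * Q p x"
begin

section \<open>The quadratic form of the polarization\<close>

abbreviation q :: "'v \<Rightarrow> real" where "q x \<equiv> Q x x"

lemmas Q_simps = bilinear_ladd[OF bilinear_Q] bilinear_radd[OF bilinear_Q]
  bilinear_lsub[OF bilinear_Q] bilinear_rsub[OF bilinear_Q]
  bilinear_lmul[OF bilinear_Q] bilinear_rmul[OF bilinear_Q]
  bilinear_lneg[OF bilinear_Q] bilinear_rneg[OF bilinear_Q]
  bilinear_lzero[OF bilinear_Q] bilinear_rzero[OF bilinear_Q]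

lemma q_nonneg: "q x \<ge> 0"
  using Q_pos[of x] by (cases "x = 0") (auto simp: Q_simps)

lemma q_diff: "q (x - y) = q x - 2 * Q y x + q y"
  using Q_commute[of x y] by (simp add: Q_simps)

lemma q_add: "q (x + y) = q x + 2 * Q y x + q y"
  using Q_commute[of x y] by (simp add: Q_simps)

text \<open>Parallelogram law with the term \<open>q (x + y)\<close> dropped.\<close>

lemma q_diff_le: "q (x - y) \<le> 2 * q x + 2 * q y"
  using q_nonneg[of "x + y"] by (simp add: q_diff q_add)

lemma continuous_on_Q [continuous_intros]:
  "continuous_on S f \<Longrightarrow> continuous_on S g \<Longrightarrow> continuous_on S (\<lambda>x. Q (f x) (g x))"
  using bilinear_Q bilinear_conv_bounded_bilinear bounded_bilinear.continuous_on by blast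

lemma linear_Q: "linear (Q p)"
  using bilinear_Q by (simp add: bilinear_def)

lemma zero_P: "0 \<in> P"
  using zero_M' M'_subset_P by blast

lemma add_P: "p \<in> P \<Longrightarrow> r \<in> P \<Longrightarrow> p + r \<in> P"
  using diff_P[of p "0 - r"] diff_P[of 0 r] zero_P by simp

lemma uminus_M': "u \<in> M' \<Longrightarrow> - u \<in> M'"
  using diff_M'[of 0 u] zero_M' by simp

lemma add_M': "u \<in> M' \<Longrightarrow> v \<in> M' \<Longrightarrow> u + v \<in> M'"
  using diff_M'[of u "- v"] uminus_M' by simp


subsection \<open>Voronoi cells and short vectors\<close>

text \<open>The linear form of the condition that \<open>0\<close> is a point of \<open>L\<close>
  nearest to \<open>z\<close>: the terms \<open>q z\<close> cancel, so each \<open>u\<close>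
  contributes a half-space.\<close>

definition voronoi :: "'v set \<Rightarrow> 'v set" where
  "voronoi L = {z. \<forall>u\<in>L. 2 * Q u z \<le> q u}"

lemma voronoi_iff: "z \<in> voronoi L \<longleftrightarrow> (\<forall>u\<in>L. q z \<le> q (z - u))"
  by (auto simp: voronoi_def q_diff)

text \<open>Only points with \<open>q (z - u) \<le> q z\<close> compete. They satisfy
  \<open>q u \<le> 4 * q z\<close> by \<open>q_diff_le\<close>, so there are finitely many, and
  \<open>0\<close> is one of them.\<close>

lemma ex_nearest:
  assumes "L \<subseteq> P" "0 \<in> L"
  obtains u where "u \<in> L" "\<And>v. v \<in> L \<Longrightarrow> q (z - u) \<le> q (z - v)"
proof -
  let ?A = "{u \<in> L. q (z - u) \<le> q z}"
  have "?A \<subseteq> {p \<in> P. q p \<le> 4 * q z}"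
  proof clarsimp
    fix u assume "u \<in> L" "q (z - u) \<le> q z"
    then show "u \<in> P \<and> q u \<le> 4 * q z"
      using assms(1) q_diff_le[of z "z - u"] by auto
  qed
  then have fin: "finite ?A"
    using finite_sublevel_P finite_subset by blast
  have ne: "?A \<noteq> {}"
    using assms(2) by auto
  define u where "u = arg_min_on (\<lambda>u. q (z - u)) ?A"
  have u: "u \<in> ?A" "\<And>v. v \<in> ?A \<Longrightarrow> q (z - u) \<le> q (z - v)"
    unfolding u_def by (rule arg_min_if_finite(1)[OF fin ne], rule arg_min_least[OF fin ne])
  show thesis
  proof (rule that[of u])
    show "u \<in> L"
      using u(1) by simp
    show "q (z - u) \<le> q (z - v)" if "v \<in> L" for v
      using u(1) u(2)[of v] that by (cases "q (z - v) \<le> q z") auto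
  qed
qed

lemma ex_voronoi_M': obtains u where "u \<in> M'" "z - u \<in> voronoi M'"
proof -
  obtain u where u: "u \<in> M'" "\<And>v. v \<in> M' \<Longrightarrow> q (z - u) \<le> q (z - v)"
    using ex_nearest[OF M'_subset_P zero_M'] by blast
  have "q (z - u) \<le> q (z - u - v)" if "v \<in> M'" for v
    using u(2)[OF add_M'[OF u(1) that]] by (simp add: algebra_simps)
  then show thesis
    using that[OF u(1)] by (simp add: voronoi_iff)
qed

lemma ex_voronoi_P: obtains p where "p \<in> P" "z - p \<in> voronoi P"
proof -
  obtain u where u: "u \<in> P" "\<And>v. v \<in> P \<Longrightarrow> q (z - u) \<le> q (z - v)"
    using ex_nearest[OF order.refl zero_P] by blast
  have "q (z - u) \<le> q (z - u - v)" if "v \<in> P" for v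
    using u(2)[OF add_P[OF u(1) that]] by (simp add: algebra_simps)
  then show thesis
    using that[OF u(1)] by (simp add: voronoi_iff)
qed

text \<open>The Voronoi inequality of \<open>z\<close> is tested against \<open>u / d\<close>, which
  lies in \<open>P\<close>.\<close>

lemma voronoi_P_scale:
  assumes "z \<in> voronoi P" "u \<in> M'"
  shows "2 * d * Q u z \<le> q u"
proof -
  have "2 * (Q u z / d) \<le> q u / d / d"
    using assms divide_M'[OF assms(2)] unfolding voronoi_def by (force simp: Q_simps)
  then show ?thesis
    using d_ge_3 by (simp add: field_simps)
qed

text \<open>Equivalently, \<open>0\<close> and \<open>s\<close> are both points of \<open>P\<close>
  nearest to \<open>s / 2\<close>.\<close>

definition short :: "'v set" where
  "short = {s \<in> P. \<forall>p\<in>P. Q p s \<le> q p}"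

lemma short_iff: "s \<in> short \<longleftrightarrow> s \<in> P \<and> (1 / 2) *\<^sub>R s \<in> voronoi P"
  by (auto simp: short_def voronoi_def Q_simps)

lemma short_scale:
  assumes "s \<in> short" "u \<in> M'"
  shows "d * Q u s \<le> q u"
  using voronoi_P_scale[of "(1 / 2) *\<^sub>R s" u] assms by (simp add: short_iff Q_simps)

lemma zero_short: "0 \<in> short"
  by (simp add: short_def zero_P Q_simps q_nonneg)

text \<open>If \<open>p\<close> is not short, some \<open>m \<in> P\<close> has \<open>Q m (p - m) > 0\<close>, so both \<open>m\<close> and \<open>p - m\<close> are
  smaller than \<open>p\<close>.\<close>

lemma short_generates:
  assumes short: "short \<subseteq> G" and add: "\<And>a b. a \<in> G \<Longrightarrow> b \<in> G \<Longrightarrow> a + b \<in> G"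
  shows "P \<subseteq> G"
proof
  fix p assume "p \<in> P"
  \<comment> \<open>The values of \<open>q\<close> are real, so the induction runs over the number
    of points of \<open>P\<close> with a smaller value, which is finite.\<close>
  then show "p \<in> G"
  proof (induction "card {r \<in> P. q r < q p}" arbitrary: p rule: less_induct)
    case less
    have smaller: "card {r \<in> P. q r < q a} < card {r \<in> P. q r < q p}" if "a \<in> P" "q a < q p" for a
    proof (rule psubset_card_mono)
      show "finite {r \<in> P. q r < q p}"
        by (rule finite_subset[OF _ finite_sublevel_P[of "q p"]]) auto
      show "{r \<in> P. q r < q a} \<subset> {r \<in> P. q r < q p}"
        using that by auto
    qed
    show ?case
    proof (cases "p \<in> short")
      case False
      then obtain m where m: "m \<in> P" "Q m p > q m"
        using less.prems by (auto simp: short_def not_le)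
      let ?b = "p - m"
      have Qmb: "Q m ?b > 0"
        using m(2) by (simp add: Q_simps)
      then have "m \<noteq> 0" "?b \<noteq> 0"
        using bilinear_lzero[OF bilinear_Q] bilinear_rzero[OF bilinear_Q] by (metis less_irrefl)+
      then have "q m > 0" "q ?b > 0"
        by (simp_all only: Q_pos not_False_eq_True)
      moreover have "q p = q m + 2 * Q m ?b + q ?b"
        by (simp add: Q_simps Q_commute[of p m])
      ultimately have "q m < q p" "q ?b < q p"
        using Qmb by linarith+
      then have "m \<in> G" "?b \<in> G"
        using less.hyps smaller m(1) diff_P[OF less.prems m(1)] by blast+
      then show ?thesis
        using add[of m ?b] by simp
    qed (use short in blast)
  qed
qed

text \<open>The bounds \<open>q u / d\<close> for \<open>2 * Q u z\<close> and
  \<open>2 * q u / d\<close> for \<open>- 2 * Q u s\<close> add up to \<open>3 * q u / d\<close>,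
  which is at most \<open>q u\<close>.\<close>

lemma short_near:
  assumes "z \<in> voronoi P" "s \<in> short"
  shows "z - s \<in> voronoi M'"
  unfolding voronoi_def
proof clarify
  fix u assume u: "u \<in> M'"
  have "2 * d * Q u z \<le> q u" "- (d * Q u s) \<le> q u"
    using voronoi_P_scale[OF assms(1) u] short_scale[OF assms(2) uminus_M'[OF u]]
    by (simp_all add: Q_simps)
  then have "d * (2 * Q u (z - s)) \<le> 3 * q u"
    by (simp add: Q_simps algebra_simps)
  also have "\<dots> \<le> d * q u"
    using d_ge_3 q_nonneg by (intro mult_right_mono)
  finally show "2 * Q u (z - s) \<le> q u"
    using d_ge_3 by simp
qed

text \<open>With \<open>u = t - s\<close>, the bounds of \<open>short_scale\<close> at
  \<open>u\<close> and \<open>- u\<close> add up to \<open>d * q u \<le> 2 * q u\<close>. Hence a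
  coset of \<open>M'\<close> contains at most one short vector.\<close>

lemma short_eqI:
  assumes "s \<in> short" "t \<in> short" "t - s \<in> M'"
  shows "s = t"
proof (rule ccontr)
  let ?u = "t - s"
  assume "s \<noteq> t"
  then have "q ?u > 0"
    by (simp add: Q_pos)
  moreover have "d * Q ?u t \<le> q ?u" "- (d * Q ?u s) \<le> q ?u"
    using short_scale[OF assms(2,3)] short_scale[OF assms(1) uminus_M'[OF assms(3)]]
    by (simp_all only: Q_simps minus_mult_right Q_commute[of s t])
  then have "d * q ?u \<le> 2 * q ?u"
    by (simp add: Q_simps algebra_simps)
  ultimately show False
    using d_ge_3 by simp
qed

text \<open>Some \<open>u\<close> in \<open>M'\<close> is within norm \<open>r\<close> of
  \<open>z\<close>, and \<open>0\<close> is at least as near to \<open>z\<close> for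
  \<open>q\<close>; so \<open>q z\<close> is bounded by the values of \<open>q\<close> on a
  ball.\<close>

lemma voronoi_M'_bounded: obtains \<rho> where "\<rho> \<ge> 0" "\<And>z. z \<in> voronoi M' \<Longrightarrow> q z \<le> \<rho>"
proof -
  obtain r where r: "\<And>x. \<exists>u\<in>M'. norm (x - u) \<le> r"
    using cocompact_M' by blast
  have "compact (q ` cball 0 r)"
    by (rule compact_continuous_image[OF continuous_on_Q[OF continuous_on_id continuous_on_id] compact_cball])
  then have "bdd_above (q ` cball 0 r)"
    by (intro bounded_imp_bdd_above compact_imp_bounded)
  then obtain \<rho> where \<rho>: "\<And>x. x \<in> cball 0 r \<Longrightarrow> q x \<le> \<rho>"
    unfolding bdd_above_def by blast
  have "q z \<le> max 0 \<rho>" if z: "z \<in> voronoi M'" for z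
  proof -
    obtain u where u: "u \<in> M'" "norm (z - u) \<le> r"
      using r by blast
    then have "q z \<le> q (z - u)"
      using z by (simp add: voronoi_iff)
    also have "\<dots> \<le> \<rho>"
      using u \<rho> by simp
    finally show ?thesis
      by simp
  qed
  then show thesis
    using that[of "max 0 \<rho>"] by simp
qed

text \<open>Nonnegativity of \<open>q (u - 2 *\<^sub>R z)\<close> gives
  \<open>4 * Q u z \<le> q u + 4 * q z\<close>.\<close>

lemma Q_le_of_far:
  assumes "4 * q z \<le> q u"
  shows "2 * Q u z \<le> q u"
  using q_nonneg[of "u - 2 *\<^sub>R z"] assms by (simp add: Q_simps Q_commute[of z u])

text \<open>By \<open>Q_le_of_far\<close>, vectors outside \<open>T\<close> exclude no point with
  \<open>q z \<le> \<rho> + 1\<close>. As \<open>voronoi T\<close> is star-shaped, a point of it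
  beyond that level could be shrunk onto it, giving a point of \<open>voronoi M'\<close> above the
  bound \<open>\<rho>\<close>.\<close>

lemma voronoi_M'_finite:
  obtains T where "finite T" "T \<subseteq> M'" "voronoi M' = voronoi T"
proof -
  obtain \<rho> where \<rho>: "\<rho> \<ge> 0" "\<And>z. z \<in> voronoi M' \<Longrightarrow> q z \<le> \<rho>"
    using voronoi_M'_bounded by blast
  define T where "T = {u \<in> M'. q u \<le> 4 * (\<rho> + 1)}"
  have near: "z \<in> voronoi M'" if "z \<in> voronoi T" "q z \<le> \<rho> + 1" for z
    unfolding voronoi_def
  proof clarify
    fix u assume "u \<in> M'"
    then show "2 * Q u z \<le> q u"
      using that Q_le_of_far[of z u] by (cases "u \<in> T") (auto simp: T_def voronoi_def)
  qed
  have "z \<in> voronoi M'" if z: "z \<in> voronoi T" for z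
  proof (rule ccontr)
    assume nin: "z \<notin> voronoi M'"
    then have big: "q z > \<rho> + 1"
      using near[OF z] by force
    define t where "t = sqrt ((\<rho> + 1) / q z)"
    have t: "0 \<le> t" "t \<le> 1" "t * t * q z = \<rho> + 1"
      using big \<rho>(1) by (simp_all add: t_def)
    have "t *\<^sub>R z \<in> voronoi T"
      unfolding voronoi_def
    proof clarify
      fix u assume "u \<in> T"
      then have "t * (2 * Q u z) \<le> t * q u"
        using z t(1) by (intro mult_left_mono) (auto simp: voronoi_def)
      also have "\<dots> \<le> q u"
        using t(2) q_nonneg[of u] mult_right_mono[of t 1 "q u"] by simp
      finally show "2 * Q u (t *\<^sub>R z) \<le> q u"
        by (simp add: Q_simps)
    qed
    then have "t *\<^sub>R z \<in> voronoi M'"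
      using near t(3) by (simp add: Q_simps mult.assoc)
    then show False
      using \<rho>(2)[of "t *\<^sub>R z"] t(3) by (simp add: Q_simps mult.assoc)
  qed
  then have "voronoi M' = voronoi T"
    by (auto simp: voronoi_def T_def)
  moreover have "finite T"
    by (rule finite_subset[OF _ finite_sublevel_P[of "4 * (\<rho> + 1)"]])
      (use M'_subset_P in \<open>auto simp: T_def\<close>)
  ultimately show thesis
    using that[of T] by (auto simp: T_def)
qed


subsection \<open>The polyhedral decomposition\<close>

text \<open>\<open>p \<in> active x\<close> means that \<open>p\<close> is a point of its coset \<open>p + M'\<close> nearest to \<open>x + c\<close>.\<close>

definition active :: "'v \<Rightarrow> 'v set" where
  "active x = {p \<in> P. x + c - p \<in> voronoi M'}"

text \<open>The smallest closed cell containing \<open>y\<close>; different \<open>y\<close> may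
  give the same cell, so the complex is \<open>range cell\<close>.\<close>

definition cell :: "'v \<Rightarrow> 'v set" where
  "cell y = {x. active y \<subseteq> active x}"

lemma active_subset_P: "active x \<subseteq> P"
  by (auto simp: active_def)

lemma active_le:
  assumes "p \<in> active x" "r - p \<in> M'"
  shows "q (x + c - p) \<le> q (x + c - r)"
proof -
  have "x + c - r = x + c - p - (r - p)"
    by simp
  then show ?thesis
    using assms unfolding active_def voronoi_iff by (metis (no_types, lifting) mem_Collect_eq)
qed

lemma activeI:
  assumes "p \<in> active x" "r \<in> P" "r - p \<in> M'" "q (x + c - r) \<le> q (x + c - p)"
  shows "r \<in> active x"
  unfolding active_def voronoi_iff
proof clarify
  have "q (x + c - r) \<le> q (x + c - r - u)" if "u \<in> M'" for u
    using active_le[OF assms(1), of "r + u"] add_M'[OF assms(3) that] assms(4)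
    by (simp add: algebra_simps)
  then show "r \<in> P \<and> (\<forall>u\<in>M'. q (x + c - r) \<le> q (x + c - r - u))"
    using assms(2) by blast
qed

lemma ex_active:
  assumes "p \<in> P"
  obtains r where "r \<in> active x" "r - p \<in> M'"
proof -
  obtain u where u: "u \<in> M'" "x + c - p - u \<in> voronoi M'"
    using ex_voronoi_M' by blast
  then have "p + u \<in> active x"
    using assms add_P M'_subset_P by (auto simp: active_def algebra_simps)
  then show thesis
    using that u(1) by simp
qed

text \<open>Active points differ from \<open>x + c\<close> by elements of the bounded Voronoi cell
  of \<open>M'\<close>, so a bounded set of \<open>x\<close> meets only finitely many; this yields
  local finiteness.\<close>

lemma finite_active_Union: "finite (\<Union>x\<in>{x. q (x + c) \<le> K}. active x)"
proof -
  obtain \<rho> where \<rho>: "\<rho> \<ge> 0" "\<And>z. z \<in> voronoi M' \<Longrightarrow> q z \<le> \<rho>"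
    using voronoi_M'_bounded by blast
  have "(\<Union>x\<in>{x. q (x + c) \<le> K}. active x) \<subseteq> {p \<in> P. q p \<le> 2 * K + 2 * \<rho>}"
  proof clarsimp
    fix x p assume "q (x + c) \<le> K" "p \<in> active x"
    then show "p \<in> P \<and> q p \<le> 2 * K + 2 * \<rho>"
      using q_diff_le[of "x + c" "x + c - p"] \<rho>(2)[of "x + c - p"] by (auto simp: active_def)
  qed
  then show ?thesis
    using finite_sublevel_P finite_subset by blast
qed

lemma finite_active: "finite (active x)"
  by (rule finite_subset[OF _ finite_active_Union[of "q (x + c)"]]) auto

text \<open>The quadratic terms cancel: the difference of the squared distances to two fixed points
  is affine along a segment.\<close>

lemma q_diff_affine:
  "q ((1 - t) *\<^sub>R x + t *\<^sub>R y + c - p) - q ((1 - t) *\<^sub>R x + t *\<^sub>R y + c - r) =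
    (1 - t) * (q (x + c - p) - q (x + c - r)) + t * (q (y + c - p) - q (y + c - r))"
proof -
  have *: "q (z + c - p) - q (z + c - r) = 2 * Q (r - p) (z + c) + q p - q r" for z
    by (simp add: q_diff) (simp add: Q_simps)
  show ?thesis
    unfolding * by (simp add: Q_simps algebra_simps)
qed

text \<open>Compare \<open>p\<close> with a point \<open>r\<close> of its coset that is active at
  \<open>y\<close>, hence at \<open>a\<close> and \<open>b\<close>. The affine difference of squared
  distances to \<open>p\<close> and \<open>r\<close> is nonnegative at both ends and nonpositive at
  the inner point \<open>z\<close>, so it vanishes at \<open>a\<close>.\<close>

lemma active_open_segment:
  assumes "a \<in> cell y" "b \<in> cell y" "z \<in> open_segment a b"
  shows "active z \<subseteq> active a"
proof
  fix p assume p: "p \<in> active z"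
  obtain t where t: "0 < t" "t < 1" "z = (1 - t) *\<^sub>R a + t *\<^sub>R b"
    using assms(3) by (auto simp: in_segment)
  obtain r where r: "r \<in> active y" "r - p \<in> M'"
    using ex_active p active_subset_P by blast
  have pr: "p - r \<in> M'"
    using uminus_M'[OF r(2)] by simp
  have ra: "r \<in> active a" "r \<in> active b"
    using r(1) assms by (auto simp: cell_def)
  have "q (a + c - p) - q (a + c - r) \<ge> 0" "q (b + c - p) - q (b + c - r) \<ge> 0"
    using active_le[OF ra(1) pr] active_le[OF ra(2) pr] by auto
  moreover have "(1 - t) * (q (a + c - p) - q (a + c - r)) + t * (q (b + c - p) - q (b + c - r)) \<le> 0"
    using active_le[OF p r(2)] unfolding q_diff_affine[symmetric] t(3)[symmetric] by simp
  ultimately have "(1 - t) * (q (a + c - p) - q (a + c - r)) \<le> 0"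
    using t by (smt (verit) mult_nonneg_nonneg)
  then have "q (a + c - p) \<le> q (a + c - r)"
    using t by (simp add: mult_le_0_iff)
  then show "p \<in> active a"
    using activeI[OF ra(1) _ pr] p active_subset_P by blast
qed

lemma convex_cell: "convex (cell y)"
proof (rule convexI)
  fix a b and s t :: real
  assume ab: "a \<in> cell y" "b \<in> cell y" and st: "0 \<le> s" "0 \<le> t" "s + t = 1"
  have "p \<in> active (s *\<^sub>R a + t *\<^sub>R b)" if "p \<in> active y" for p
  proof -
    have "a + c - p \<in> voronoi M'" "b + c - p \<in> voronoi M'" "p \<in> P"
      using ab that by (auto simp: cell_def active_def)
    moreover have "s *\<^sub>R a + t *\<^sub>R b + c - p = s *\<^sub>R (a + c - p) + t *\<^sub>R (b + c - p)"
    proof -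
      have "c - p = (s + t) *\<^sub>R (c - p)"
        using st by simp
      then show ?thesis
        by (simp add: algebra_simps)
    qed
    moreover have "2 * Q u (s *\<^sub>R z + t *\<^sub>R z') \<le> q u" if "2 * Q u z \<le> q u" "2 * Q u z' \<le> q u" for u z z'
      using convex_bound_le[OF that st] by (simp add: Q_simps algebra_simps)
    ultimately show ?thesis
      by (auto simp: active_def voronoi_def)
  qed
  then show "s *\<^sub>R a + t *\<^sub>R b \<in> cell y"
    by (auto simp: cell_def)
qed

lemma cell_Int_face: "(cell y \<inter> cell y') face_of cell y"
  unfolding face_of_def
proof (intro conjI ballI impI)
  show "convex (cell y \<inter> cell y')"
    by (intro convex_Int convex_cell)
  fix a b x assume ab: "a \<in> cell y" "b \<in> cell y" and x: "x \<in> cell y \<inter> cell y'" "x \<in> open_segment a b"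
  have "active x \<subseteq> active a" "active x \<subseteq> active b"
    using active_open_segment ab x(2) open_segment_commute by blast+
  then show "a \<in> cell y \<inter> cell y'" "b \<in> cell y \<inter> cell y'"
    using ab x(1) by (auto simp: cell_def)
qed auto

text \<open>Of the finitely many inequalities that cut out \<open>cell y\<close>, those tight at
  \<open>z\<close> are tight at \<open>x\<close> too, hence on the whole line through both; the
  others are strict at \<open>z\<close> and survive a small step.\<close>

lemma cell_extend:
  assumes z: "z \<in> cell y" and x: "x \<in> cell z"
  obtains e where "e > 0" "z + e *\<^sub>R (z - x) \<in> cell y"
proof -
  obtain T where T: "finite T" "T \<subseteq> M'" "voronoi M' = voronoi T"
    using voronoi_M'_finite by blast
  have "\<forall>\<^sub>F e in at_right 0. 2 * Q u (z + e *\<^sub>R (z - x) + c - p) \<le> q u"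
    if p: "p \<in> active y" and u: "u \<in> T" for p u
  \<comment> \<open>For \<open>p\<close> active at \<open>z\<close>, activity of
    \<open>p + u\<close> means that the inequality of \<open>u\<close> is an equality at
    \<open>z\<close>.\<close>
  proof (cases "p + u \<in> active z")
    case True
    then have "p \<in> active z" "p \<in> active x" "p + u \<in> active x" "u \<in> M'"
      using p z x u T(2) by (auto simp: cell_def)
    then have "q (z + c - p) = q (z + c - (p + u))" "q (x + c - p) = q (x + c - (p + u))"
      using True active_le[of p _ "p + u"] active_le[of "p + u" _ p] uminus_M'
      by (auto intro!: antisym)
    then have "2 * Q u (z + c - p) = q u" "2 * Q u (x + c - p) = q u"
      using q_diff[of "z + c - p" u] q_diff[of "x + c - p" u] by (simp_all add: algebra_simps)
    then have "2 * Q u (z + e *\<^sub>R (z - x) + c - p) = q u" for e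
      by (simp add: Q_simps algebra_simps) algebra
    then show ?thesis
      by simp
  next
    case False
    have pz: "p \<in> active z" and uM: "u \<in> M'"
      using p z u T(2) by (auto simp: cell_def)
    have "q (z + c - (p + u)) > q (z + c - p)"
    proof (rule ccontr)
      assume "\<not> ?thesis"
      moreover have "p + u \<in> P"
        using pz uM active_subset_P M'_subset_P add_P by blast
      ultimately show False
        using activeI[OF pz, of "p + u"] False uM by simp
    qed
    then have "2 * Q u (z + 0 *\<^sub>R (z - x) + c - p) < q u"
      using q_diff[of "z + c - p" u] by (simp add: algebra_simps)
    moreover have "((\<lambda>e. 2 * Q u (z + e *\<^sub>R (z - x) + c - p)) \<longlongrightarrow>
        2 * Q u (z + 0 *\<^sub>R (z - x) + c - p)) (at_right 0)"
      by (intro tendsto_intros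
          bounded_linear.tendsto[OF linear_conv_bounded_linear[THEN iffD1, OF linear_Q]])
    ultimately have "\<forall>\<^sub>F e in at_right 0. 2 * Q u (z + e *\<^sub>R (z - x) + c - p) < q u"
      by (intro order_tendstoD)
    then show ?thesis
      by (rule eventually_mono) simp
  qed
  then have "\<forall>\<^sub>F e in at_right 0. \<forall>p\<in>active y. \<forall>u\<in>T. 2 * Q u (z + e *\<^sub>R (z - x) + c - p) \<le> q u"
    using finite_active T(1) by (intro eventually_ball_finite ballI) auto
  moreover have "\<forall>\<^sub>F e in at_right 0. e > (0::real)"
    by (simp add: eventually_at_right_less)
  ultimately have "\<forall>\<^sub>F e in at_right 0. e > 0 \<and>
      (\<forall>p\<in>active y. \<forall>u\<in>T. 2 * Q u (z + e *\<^sub>R (z - x) + c - p) \<le> q u)"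
    by eventually_elim blast
  then obtain e where e: "e > 0"
      "\<forall>p\<in>active y. \<forall>u\<in>T. 2 * Q u (z + e *\<^sub>R (z - x) + c - p) \<le> q u"
    using eventually_happens[of _ "at_right (0::real)"] trivial_limit_at_right_real by blast
  then have "z + e *\<^sub>R (z - x) \<in> cell y"
    using T(3) by (auto simp: cell_def active_def voronoi_def)
  then show thesis
    using that e(1) by blast
qed

text \<open>Take \<open>z\<close> in the relative interior of \<open>F\<close>. A segment from
  \<open>x\<close> in \<open>F\<close> extends past \<open>z\<close> inside \<open>F\<close>, so
  \<open>active_open_segment\<close> puts \<open>x\<close> into \<open>cell z\<close>. Conversely
  \<open>cell_extend\<close> makes \<open>z\<close> an inner point of a segment in
  \<open>cell y\<close> starting at \<open>x\<close>, and the face property forces \<open>x\<close>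
  into \<open>F\<close>.\<close>

lemma face_cell:
  assumes F: "F face_of cell y" and "F \<noteq> {}"
  shows "F \<in> range cell"
proof -
  have "convex F"
    using F face_of_imp_convex by blast
  then obtain z where z: "z \<in> rel_interior F"
    using assms(2) rel_interior_eq_empty by blast
  then have zF: "z \<in> F" and zy: "z \<in> cell y"
    using rel_interior_subset F face_of_imp_subset by blast+
  have "F = cell z"
  proof
    show "F \<subseteq> cell z"
    proof
      fix x assume x: "x \<in> F"
      show "x \<in> cell z"
      proof (cases "x = z")
        case False
        obtain e where e: "e > 1" "(1 - e) *\<^sub>R x + e *\<^sub>R z \<in> F"
          using convex_rel_interior_iff[OF \<open>convex F\<close> assms(2)] z x by metis
        let ?b = "(1 - e) *\<^sub>R x + e *\<^sub>R z"
        have "z \<in> open_segment x ?b"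
        proof -
          have "z = (1 - 1 / e) *\<^sub>R x + (1 / e) *\<^sub>R ?b"
            using e(1) by (simp add: algebra_simps)
          moreover have "x \<noteq> ?b"
            using e(1) False by (simp add: algebra_simps flip: scaleR_right_diff_distrib)
          ultimately show ?thesis
            unfolding in_segment using e(1) by (intro conjI exI[of _ "1 / e"]) auto
        qed
        then show ?thesis
          using active_open_segment[of x y ?b z] x e(2) F face_of_imp_subset
          by (auto simp: cell_def)
      qed (simp add: cell_def)
    qed
    show "cell z \<subseteq> F"
    proof
      fix x assume x: "x \<in> cell z"
      show "x \<in> F"
      proof (cases "x = z")
        case False
        obtain e where e: "e > 0" "z + e *\<^sub>R (z - x) \<in> cell y"
          using cell_extend[OF zy x] .
        let ?b = "z + e *\<^sub>R (z - x)"
        have "z \<in> open_segment x ?b"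
        proof -
          \<comment> \<open>The parameter at which the segment from \<open>x\<close> to
            \<open>?b\<close> passes through \<open>z\<close>.\<close>
          define t where "t = 1 / (1 + e)"
          have t: "0 < t" "t < 1" "t + t * e = 1"
            using e(1) by (simp_all add: t_def field_simps)
          have "(1 - t) *\<^sub>R x + t *\<^sub>R ?b = (1 - (t + t * e)) *\<^sub>R x + (t + t * e) *\<^sub>R z"
            by (simp add: algebra_simps)
          then have "z = (1 - t) *\<^sub>R x + t *\<^sub>R ?b"
            using t(3) by simp
          moreover have "x \<noteq> ?b"
          proof
            assume "x = ?b"
            then have "(1 + e) *\<^sub>R (z - x) = 0"
              by (simp add: algebra_simps)
            then show False
              using e(1) False by simp
          qed
          ultimately show ?thesis
            unfolding in_segment using t by blast
        qed
        moreover have "x \<in> cell y"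
          using x zy by (auto simp: cell_def)
        ultimately show ?thesis
          using F e(2) zF unfolding face_of_def by blast
      qed (use zF in simp)
    qed
  qed
  then show ?thesis
    by blast
qed

lemma rational_polyhedron_cell: "rational_polyhedron pair (cell y)"
proof -
  obtain T where T: "finite T" "T \<subseteq> M'" "voronoi M' = voronoi T"
    using voronoi_M'_finite by blast
  \<comment> \<open>The sign is reversed because rational polyhedra are cut out by lower
    bounds.\<close>
  have "\<exists>w. \<forall>x. pair w x = Q (- u) x" if "u \<in> T" for u
    using slope_M' uminus_M' T(2) that by blast
  then obtain w where w: "\<And>u x. u \<in> T \<Longrightarrow> pair (w u) x = - Q u x"
    unfolding Q_simps by metis
  define I where "I = (\<lambda>(p, u). (w u, Q u (c - p) - q u / 2)) ` (active y \<times> T)"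
  have "finite I"
    unfolding I_def using T(1) finite_active by blast
  moreover have "cell y = {x. \<forall>(u, b)\<in>I. pair u x \<ge> b}"
  proof -
    have ineq: "2 * Q u (x + c - p) \<le> q u \<longleftrightarrow> pair (w u) x \<ge> Q u (c - p) - q u / 2" if "u \<in> T" for u x p
      using w[OF that] by (auto simp: Q_simps field_simps)
    have "x \<in> cell y \<longleftrightarrow> (\<forall>p\<in>active y. \<forall>u\<in>T. 2 * Q u (x + c - p) \<le> q u)" for x
      using T(3) by (auto simp: cell_def active_def voronoi_def)
    then have "x \<in> cell y \<longleftrightarrow> (\<forall>(u, b)\<in>I. pair u x \<ge> b)" for x
      unfolding I_def using ineq by (force simp: split_beta)
    then show ?thesis
      by blast
  qed
  ultimately show ?thesis
    unfolding rational_polyhedron_def by blast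
qed

text \<open>A cell depends only on the active set of its index. If it meets \<open>?U\<close>, that
  set is a subset of the finite set of all points active somewhere on \<open>?U\<close>.\<close>

lemma locally_finite_cells: "locally_finite_in euclidean (range cell)"
  unfolding locally_finite_in_def
proof (intro conjI ballI)
  fix x :: 'v
  let ?U = "{z. q (z + c) < q (x + c) + 1}"
  have "open ?U"
    by (intro open_Collect_less continuous_intros)
  moreover have "finite {C \<in> range cell. C \<inter> ?U \<noteq> {}}"
  proof (rule finite_subset)
    let ?A = "\<Union>x\<in>{z. q (z + c) \<le> q (x + c) + 1}. active x"
    show "finite ((\<lambda>S. {x. S \<subseteq> active x}) ` Pow ?A)"
      using finite_active_Union by blast
    show "{C \<in> range cell. C \<inter> ?U \<noteq> {}} \<subseteq> (\<lambda>S. {x. S \<subseteq> active x}) ` Pow ?A"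
    proof
      fix C assume "C \<in> {C \<in> range cell. C \<inter> ?U \<noteq> {}}"
      then obtain y z where C: "C = cell y" and "z \<in> cell y" "q (z + c) < q (x + c) + 1"
        by blast
      then have "active y \<subseteq> active z" "z \<in> {z. q (z + c) \<le> q (x + c) + 1}"
        by (auto simp: cell_def)
      then have "active y \<subseteq> ?A"
        by blast
      then show "C \<in> (\<lambda>S. {x. S \<subseteq> active x}) ` Pow ?A"
        unfolding C cell_def by blast
    qed
  qed
  ultimately show "\<exists>V. openin euclidean V \<and> x \<in> V \<and> finite {U \<in> range cell. U \<inter> V \<noteq> {}}"
    by (intro exI[of _ ?U]) auto
qed auto

lemma decomposition: "rational_polyhedral_decomposition pair (range cell)"
proof -
  have self: "y \<in> cell y" for y
    by (simp add: cell_def)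
  then have "cell y \<noteq> {}" "\<Union> (range cell) = UNIV" for y
    by blast+
  moreover have "(cell y \<inter> cell y') face_of cell y'" for y y'
    using cell_Int_face[of y' y] by (simp add: Int_commute)
  ultimately show ?thesis
    unfolding rational_polyhedral_decomposition_def
    using rational_polyhedron_cell face_cell cell_Int_face locally_finite_cells by blast
qed


subsection \<open>The basic theta functions\<close>

text \<open>A squared distance, that of \<open>z\<close> from the lattice \<open>M'\<close> with
  respect to \<open>q\<close>.\<close>

definition coset_dist :: "'v \<Rightarrow> real" where
  "coset_dist z = (INF u\<in>M'. q (z - u))"

text \<open>A tropical theta series with characteristic \<open>p\<close>: by \<open>theta_le\<close>
  and \<open>theta_active\<close> it is the minimum of the affine functions
  \<open>d * (q r / 2 - Q r (x + c))\<close> over \<open>r\<close> in \<open>p + M'\<close>.\<close>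

definition theta :: "'v \<Rightarrow> 'v \<Rightarrow> real" where
  "theta p x = d / 2 * (coset_dist (x + c - p) - q (x + c))"

lemma coset_dist_le: "u \<in> M' \<Longrightarrow> coset_dist z \<le> q (z - u)"
  unfolding coset_dist_def by (intro cINF_lower bdd_belowI2[where m = 0] q_nonneg)

lemma coset_dist_eq: "z \<in> voronoi M' \<Longrightarrow> coset_dist z = q z"
  unfolding coset_dist_def
  by (intro cInf_eq_minimum) (use zero_M' in \<open>force simp: voronoi_iff\<close>)+

lemma coset_dist_shift:
  assumes "u \<in> M'"
  shows "coset_dist (z - u) = coset_dist z"
proof -
  have "(\<lambda>v. u + v) ` M' = M'"
  proof
    show "M' \<subseteq> (\<lambda>v. u + v) ` M'"
    proof
      fix v assume "v \<in> M'"
      then have "v - u \<in> M'" "v = u + (v - u)"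
        using diff_M' assms by auto
      then show "v \<in> (\<lambda>v. u + v) ` M'"
        by blast
    qed
  qed (use add_M' assms in blast)
  then have "(\<lambda>v. q (z - v)) ` M' = (\<lambda>v. q (z - u - v)) ` M'"
    by (metis (no_types, lifting) diff_diff_eq image_cong image_image)
  then show ?thesis
    by (simp add: coset_dist_def)
qed

lemma theta_le:
  assumes "r - p \<in> M'"
  shows "theta p x \<le> d * (q r / 2 - Q r (x + c))"
proof -
  have "coset_dist (x + c - p) \<le> q (x + c - r)"
    using coset_dist_le[OF assms, of "x + c - p"] by simp
  then have "d / 2 * (coset_dist (x + c - p) - q (x + c)) \<le> d / 2 * (q (x + c - r) - q (x + c))"
    using d_ge_3 by (intro mult_left_mono) auto
  then show ?thesis
    by (simp add: theta_def q_diff algebra_simps)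
qed

lemma coset_dist_active:
  assumes "r \<in> active x" "r - p \<in> M'"
  shows "coset_dist (x + c - p) = q (x + c - r)"
  using coset_dist_eq[of "x + c - r"] coset_dist_shift[OF assms(2), of "x + c - p"] assms(1)
  by (simp add: active_def)

lemma theta_active:
  assumes "r \<in> active x" "r - p \<in> M'"
  shows "theta p x = d * (q r / 2 - Q r (x + c))"
  unfolding theta_def coset_dist_active[OF assms] by (simp add: q_diff algebra_simps)

text \<open>The coset distance is periodic, so the multiplier comes from \<open>q (x + c)\<close>
  alone. Its constant part is matched with the descent datum by the choice of
  \<open>c\<close>.\<close>

lemma theta_shift:
  assumes "u \<in> M'"
  shows "theta p (x + u) = theta p x - d * Q u x - d * (q u / 2 + Q u c)"
proof -
  have "coset_dist (x + u + c - p) = coset_dist (x + c - p)"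
    using coset_dist_shift[OF assms, of "x + u + c - p"] by (simp add: algebra_simps)
  moreover have "q (x + u + c) = q (x + c) + 2 * Q u (x + c) + q u"
    using q_add[of "x + c" u] by (simp add: algebra_simps)
  ultimately show ?thesis
    by (simp add: theta_def Q_simps algebra_simps Q_commute[of c u] Q_commute[of x u])
qed

text \<open>The affine function of a point \<open>r\<close> active at the intermediate point bounds
  \<open>theta p\<close> from above everywhere and equals it there.\<close>

lemma concave_theta:
  assumes "p \<in> P"
  shows "concave_on UNIV (theta p)"
  unfolding concave_on_iff
proof (intro conjI ballI allI impI)
  fix x y :: 'v and s t :: real
  assume st: "0 \<le> s" "0 \<le> t" "s + t = 1"
  let ?z = "s *\<^sub>R x + t *\<^sub>R y"
  obtain r where r: "r \<in> active ?z" "r - p \<in> M'"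
    using ex_active[OF assms] by blast
  have "s * theta p x + t * theta p y \<le>
      s * (d * (q r / 2 - Q r (x + c))) + t * (d * (q r / 2 - Q r (y + c)))"
    using theta_le[OF r(2)] st by (intro add_mono mult_left_mono)
  also have "\<dots> = (s + t) * (d * (q r / 2 - Q r c)) - d * Q r ?z"
    by (simp add: Q_simps algebra_simps)
  also have "\<dots> = theta p ?z"
    unfolding theta_active[OF r] st(3) by (simp add: Q_simps algebra_simps)
  finally show "s * theta p x + t * theta p y \<le> theta p ?z" .
qed simp

lemma continuous_theta: "p \<in> P \<Longrightarrow> continuous_on UNIV (theta p)"
  using continuous_on_minus[OF convex_on_continuous[OF open_UNIV, of "\<lambda>x. - theta p x"]] concave_theta
  by (simp add: concave_on_def)

lemma theta_cell:
  assumes "r \<in> active y" "r - p \<in> M'" "x \<in> cell y"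
  shows "theta p x = d * (q r / 2 - Q r c) - d * Q r x"
  using theta_active[of r x p] assms by (auto simp: cell_def Q_simps algebra_simps)

lemma regular_theta:
  assumes "p \<in> P"
  shows "regular_function pair (\<lambda>x. ereal (theta p x))"
proof -
  have "\<exists>w b. \<forall>x\<in>cell y. theta p x = pair w x + b" for y
  proof -
    obtain r where r: "r \<in> active y" "r - p \<in> M'"
      using ex_active[OF assms] by blast
    then have "- r \<in> P"
      using diff_P[OF zero_P, of r] active_subset_P by auto
    then obtain w where "\<forall>x. pair w x = d * Q (- r) x"
      using slope_P by blast
    then show ?thesis
      by (intro exI[of _ w] exI[of _ "d * (q r / 2 - Q r c)"])
        (simp add: theta_cell[OF r] Q_simps)
  qed
  then have "piecewise_int_affine pair (theta p)"
    unfolding piecewise_int_affine_def using decomposition by blast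
  then show ?thesis
    unfolding regular_function_def using concave_theta[OF assms] by blast
qed


subsection \<open>Faithfulness\<close>

lemma short_active:
  assumes "p \<in> P" "y + c - p \<in> voronoi P" "s \<in> short"
  shows "p + s \<in> active y"
proof -
  have "y + c - (p + s) \<in> voronoi M'"
    using short_near[OF assms(2,3)] by (simp add: algebra_simps)
  then show ?thesis
    using assms add_P by (simp add: active_def short_iff)
qed

text \<open>The \<open>a i\<close> give the slopes at \<open>y\<close>, and the last conclusion says
  that their differences generate \<open>P\<close>. All \<open>p + s\<close> with \<open>s\<close>
  short occur among them, including \<open>p\<close> itself, so the differences contain the short
  vectors and \<open>short_generates\<close> applies.\<close>

lemma ex_generating_selection:
  fixes r :: "nat \<Rightarrow> 'v"
  assumes r: "\<And>i. i \<le> m \<Longrightarrow> r i \<in> P" and cover: "\<And>p. p \<in> P \<Longrightarrow> \<exists>i\<le>m. p - r i \<in> M'"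
  obtains a where "\<And>i. i \<le> m \<Longrightarrow> a i \<in> active y" "\<And>i. i \<le> m \<Longrightarrow> a i - r i \<in> M'"
    "\<And>G. 0 \<in> G \<Longrightarrow> (\<And>i. i < m \<Longrightarrow> a 0 - a (Suc i) \<in> G) \<Longrightarrow>
      (\<And>x y. x \<in> G \<Longrightarrow> y \<in> G \<Longrightarrow> x - y \<in> G) \<Longrightarrow> P \<subseteq> G"
proof -
  obtain p where p: "p \<in> P" "y + c - p \<in> voronoi P"
    using ex_voronoi_P by blast
  \<comment> \<open>A coset that contains a point \<open>p + s\<close> must be represented by it;
    \<open>short_eqI\<close> makes this \<open>s\<close> unique.\<close>
  have "\<exists>b. b \<in> active y \<and> b - r i \<in> M' \<and> (\<forall>s\<in>short. p + s - r i \<in> M' \<longrightarrow> b = p + s)"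
    if i: "i \<le> m" for i
  proof (cases "\<exists>s\<in>short. p + s - r i \<in> M'")
    case True
    then obtain s where s: "s \<in> short" "p + s - r i \<in> M'"
      by blast
    have "s = t" if t: "t \<in> short" "p + t - r i \<in> M'" for t
      using short_eqI[OF s(1) t(1)] diff_M'[OF t(2) s(2)] by simp
    then show ?thesis
      using s short_active[OF p s(1)] by blast
  next
    case False
    then show ?thesis
      using ex_active[OF r[OF i], of y] by metis
  qed
  then obtain a where a: "\<And>i. i \<le> m \<Longrightarrow> a i \<in> active y" "\<And>i. i \<le> m \<Longrightarrow> a i - r i \<in> M'"
    "\<And>i s. i \<le> m \<Longrightarrow> s \<in> short \<Longrightarrow> p + s - r i \<in> M' \<Longrightarrow> a i = p + s"
    by metis
  have "P \<subseteq> G" if zero: "0 \<in> G" and mem: "\<And>i. i < m \<Longrightarrow> a 0 - a (Suc i) \<in> G"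
    and diff: "\<And>x y. x \<in> G \<Longrightarrow> y \<in> G \<Longrightarrow> x - y \<in> G" for G
  proof (rule short_generates)
    have mem': "a 0 - a i \<in> G" if "i \<le> m" for i
      using that zero mem by (cases i) auto
    show "x + y \<in> G" if "x \<in> G" "y \<in> G" for x y
      using diff[OF that(1) diff[OF zero that(2)]] by simp
    have idx: "\<exists>i\<le>m. a i = p + s" if s: "s \<in> short" for s
    proof -
      have "p + s \<in> P"
        using p(1) s add_P by (simp add: short_iff)
      then show ?thesis
        using cover a(3)[OF _ s] by blast
    qed
    obtain j where j: "j \<le> m" "a j = p"
      using idx[OF zero_short] by auto
    show "short \<subseteq> G"
    proof
      fix s assume "s \<in> short"
      then obtain i where i: "i \<le> m" "a i = p + s"
        using idx by blast
      then have "s = (a 0 - a j) - (a 0 - a i)"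
        using j by simp
      then show "s \<in> G"
        using diff[OF mem'[OF j(1)] mem'[OF i(1)]] by simp
    qed
  qed
  then show thesis
    using that a(1,2) by blast
qed

lemma orthogonal_P:
  assumes "\<And>p. p \<in> P \<Longrightarrow> Q p z = 0"
  shows "z = 0"
  using assms orthogonal_M' M'_subset_P by blast

text \<open>As \<open>M\<close> consists of the forms \<open>d * Q p\<close>, the lattice
  \<open>N\<close> is dual to \<open>P\<close> under \<open>d * Q\<close>.\<close>

lemma int_dual_iff: "x \<in> int_dual pair \<longleftrightarrow> (\<forall>p\<in>P. d * Q p x \<in> \<int>)"
  unfolding int_dual_def mem_Collect_eq using slope_P slope_surj by metis

text \<open>On a cell the linear part has coordinates \<open>d * Q (a 0 - a (Suc i))\<close>, and
  the \<open>a 0 - a (Suc i)\<close> generate \<open>P\<close>. Injectivity and torsion-freeness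
  follow by applying \<open>generate\<close> to the \<open>p\<close> orthogonal to
  \<open>x - y\<close> and to the \<open>p\<close> with integral pairing against
  \<open>x / k\<close>.\<close>

lemma unimodular_theta:
  fixes r :: "nat \<Rightarrow> 'v"
  assumes r: "\<And>i. i \<le> m \<Longrightarrow> r i \<in> P" and cover: "\<And>p. p \<in> P \<Longrightarrow> \<exists>i\<le>m. p - r i \<in> M'"
    and \<phi>: "\<And>x i. i < m \<Longrightarrow> \<phi> (torus_proj M' x) i = theta (r (Suc i)) x - theta (r 0) x"
  shows "unimodular_map pair M' m \<phi>"
  unfolding unimodular_map_def
proof (intro exI[of _ "range cell"] conjI ballI)
  fix C assume "C \<in> range cell"
  then obtain y where C: "C = cell y"
    by blast
  obtain a where a: "\<And>i. i \<le> m \<Longrightarrow> a i \<in> active y" "\<And>i. i \<le> m \<Longrightarrow> a i - r i \<in> M'"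
    and generate: "\<And>G. 0 \<in> G \<Longrightarrow> (\<And>i. i < m \<Longrightarrow> a 0 - a (Suc i) \<in> G) \<Longrightarrow>
      (\<And>x y. x \<in> G \<Longrightarrow> y \<in> G \<Longrightarrow> x - y \<in> G) \<Longrightarrow> P \<subseteq> G"
    using ex_generating_selection[of m r y, OF r cover] by blast
  define F where "F x i = d * Q (a 0 - a (Suc i)) x" for x i
  \<comment> \<open>\<open>F\<close> is integral on \<open>N\<close>, so the floor only changes the
    type; coordinates from \<open>m\<close> on are padded with \<open>0\<close>.\<close>
  define h where "h x i = (if i < m then \<lfloor>F x i\<rfloor> else 0)" for x i
  define b where "b i = d * (q (a (Suc i)) / 2 - Q (a (Suc i)) c) - d * (q (a 0) / 2 - Q (a 0) c)" for i
  have a_diff: "a 0 - a (Suc i) \<in> P" if "i < m" for i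
    using a(1)[of 0] a(1)[of "Suc i"] active_subset_P that by (intro diff_P) auto
  have F_h: "F x i = of_int (h x i)" if "x \<in> int_dual pair" "i < m" for x i
    using that a_diff int_dual_iff by (auto simp: F_def h_def elim!: Ints_cases)
  have F_linear: "linear (\<lambda>x. F x i)" for i
    by (rule linearI) (simp_all add: F_def Q_simps algebra_simps)
  have "unimodular_hom pair m h"
    unfolding unimodular_hom_def
  proof (intro conjI ballI allI impI)
    show "h ` int_dual pair \<subseteq> int_vectors m"
      by (auto simp: int_vectors_def h_def)
    show "h (x + y) i = h x i + h y i" if xy: "x \<in> int_dual pair" "y \<in> int_dual pair" for x y i
    proof (cases "i < m")
      case True
      have "F (x + y) i = of_int (h x i + h y i)"
        using F_h xy True by (simp add: linear_add[OF F_linear])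
      then have "\<lfloor>F (x + y) i\<rfloor> = h x i + h y i"
        by (metis floor_of_int)
      then show ?thesis
        using True by (simp add: h_def)
    qed (simp add: h_def)
    show "inj_on h (int_dual pair)"
    proof (rule inj_onI)
      fix x y assume xy: "x \<in> int_dual pair" "y \<in> int_dual pair" "h x = h y"
      have "F x i = F y i" if "i < m" for i
        using F_h xy that by simp
      then have "P \<subseteq> {p. Q p (x - y) = 0}"
        using d_ge_3 by (intro generate) (auto simp: F_def Q_simps)
      then show "x = y"
        using orthogonal_P[of "x - y"] by auto
    qed
  next
    fix y :: "nat \<Rightarrow> int" and k :: int
    assume y: "y \<in> int_vectors m" and k: "k \<noteq> 0 \<and> (\<lambda>i. k * y i) \<in> h ` int_dual pair"
    then obtain x where x: "x \<in> int_dual pair" "(\<lambda>i. k * y i) = h x"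
      by blast
    let ?x = "(1 / of_int k) *\<^sub>R x"
    have Fx: "F ?x i = of_int (y i)" if "i < m" for i
    proof -
      have "F x i = of_int k * of_int (y i)"
        using F_h[OF x(1) that] fun_cong[OF x(2), of i] by (metis of_int_mult)
      then show ?thesis
        using k linear_cmul[OF F_linear, of "1 / of_int k" x i] by simp
    qed
    have "P \<subseteq> {p. d * Q p ?x \<in> \<int>}"
    proof (rule generate)
      show "a 0 - a (Suc i) \<in> {p. d * Q p ?x \<in> \<int>}" if "i < m" for i
        using Fx[OF that] by (simp add: F_def)
    qed (auto simp: Q_simps(1-4,9,10) right_diff_distrib intro!: Ints_diff)
    then have "?x \<in> int_dual pair"
      using int_dual_iff by blast
    moreover have "h ?x = y"
      using Fx y by (auto simp: h_def int_vectors_def fun_eq_iff)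
    ultimately show "y \<in> h ` int_dual pair"
      by blast
  qed
  moreover have "\<phi> (torus_proj M' x) i = F x i + b i" if "x \<in> C" "i < m" for x i
    using \<phi>[OF that(2), of x] theta_cell[of "a 0" y "r 0" x] theta_cell[of "a (Suc i)" y "r (Suc i)" x]
      a[of 0] a[of "Suc i"] that by (simp add: C F_def b_def Q_simps algebra_simps)
  ultimately show "\<exists>h F b. unimodular_hom pair m h \<and>
      (\<forall>i<m. linear (\<lambda>x. F x i) \<and> (\<forall>x\<in>int_dual pair. F x i = of_int (h x i))) \<and>
      (\<forall>x\<in>C. \<forall>i<m. \<phi> (torus_proj M' x) i = F x i + b i)"
    using F_linear F_h by blast
qed (rule decomposition)

lemma theta_separates:
  assumes eq: "\<And>p. p \<in> P \<Longrightarrow> theta p x - theta p y = k"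
  shows "y - x \<in> M'"
proof -
  \<comment> \<open>The common difference of the coset distances, obtained by solving the definition
    of \<open>theta\<close> for them.\<close>
  define k' where "k' = 2 * k / d + q (x + c) - q (y + c)"
  have dist: "coset_dist (x + c - p) = coset_dist (y + c - p) + k'" if "p \<in> P" for p
    using eq[OF that] d_ge_3 by (simp add: theta_def k'_def field_simps)
  obtain p where p: "p \<in> P" "x + c - p \<in> voronoi P"
    using ex_voronoi_P by blast
  obtain u where u: "u \<in> M'" "y + c - p - u \<in> voronoi M'"
    using ex_voronoi_M' by blast
  have x_active: "p + s \<in> active x" if "s \<in> short" for s
    using short_active[OF p that] .
  \<comment> \<open>The choice of \<open>u\<close> makes \<open>p\<close> nearest only within its
    coset. Since all coset distances change by the same \<open>k'\<close>, the coset that is closest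
    to \<open>x + c\<close> is also closest to \<open>y + c\<close>.\<close>
  have "y - u + c - p \<in> voronoi P"
    unfolding voronoi_iff
  proof
    fix r assume "r \<in> P"
    then have rp: "r + p \<in> P"
      using p(1) add_P by blast
    have "coset_dist (x + c - p) = q (x + c - p)"
      using coset_dist_active[OF x_active[OF zero_short], of p] zero_M' by simp
    also have "\<dots> \<le> coset_dist (x + c - (r + p))"
    proof -
      obtain r' where r': "r' \<in> active x" "r' - (r + p) \<in> M'"
        using ex_active[OF rp] by blast
      then have "r' - p \<in> P"
        using diff_P p(1) active_subset_P by blast
      then have "q (x + c - p) \<le> q (x + c - p - (r' - p))"
        using p(2) unfolding voronoi_iff by blast
      then show ?thesis
        using coset_dist_active[OF r'] by simp
    qed
    finally have "coset_dist (y + c - p) \<le> coset_dist (y + c - (r + p))"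
      using dist[OF p(1)] dist[OF rp] by simp
    moreover have "coset_dist (y + c - p) = q (y - u + c - p)"
      using coset_dist_eq[OF u(2)] coset_dist_shift[OF u(1), of "y + c - p"] by (simp add: algebra_simps)
    moreover have "coset_dist (y + c - (r + p)) \<le> q (y - u + c - p - r)"
      using coset_dist_le[OF u(1), of "y + c - (r + p)"] by (simp add: algebra_simps)
    ultimately show "q (y - u + c - p) \<le> q (y - u + c - p - r)"
      by simp
  qed
  then have y_active: "p + s \<in> active (y - u)" if "s \<in> short" for s
    using short_active[OF p(1) _ that] by blast
  have diff: "q (x + c - (p + s)) = q (y - u + c - (p + s)) + k'" if "s \<in> short" for s
  proof -
    have "p + s \<in> P"
      using x_active[OF that] active_subset_P by blast
    moreover have "coset_dist (y - u + c - (p + s)) = coset_dist (y + c - (p + s))"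
      using coset_dist_shift[OF u(1), of "y + c - (p + s)"] by (simp add: algebra_simps)
    ultimately show ?thesis
      using dist[of "p + s"] coset_dist_active[OF x_active[OF that], of "p + s"]
        coset_dist_active[OF y_active[OF that], of "p + s"] zero_M' by simp
  qed
  \<comment> \<open>Subtracting the instance \<open>s = 0\<close> of \<open>diff\<close> removes
    \<open>k'\<close> and all quadratic terms.\<close>
  have "short \<subseteq> {s. Q s (x - (y - u)) = 0}"
  proof clarify
    fix s assume "s \<in> short"
    then show "Q s (x - (y - u)) = 0"
      using diff[of s] diff[OF zero_short] q_diff[of "x + c - p" s] q_diff[of "y - u + c - p" s]
      by (simp add: Q_simps diff_diff_eq)
  qed
  then have "P \<subseteq> {s. Q s (x - (y - u)) = 0}"
    by (rule short_generates) (simp add: Q_simps(1))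
  then have "x - (y - u) = 0"
    using orthogonal_P by blast
  then have "y - x = u"
    by (simp add: algebra_simps)
  then show ?thesis
    using u(1) by simp
qed

section \<open>The compact torus and the embedding\<close>

lemma torus_proj_eq_iff: "torus_proj M' x = torus_proj M' y \<longleftrightarrow> y - x \<in> M'"
proof
  assume "torus_proj M' x = torus_proj M' y"
  moreover have "y \<in> torus_proj M' y"
    using zero_M' by (force simp: torus_proj_def)
  ultimately obtain u where "u \<in> M'" "y = x + u"
    by (auto simp: torus_proj_def)
  then show "y - x \<in> M'"
    by simp
next
  have sub: "torus_proj M' b \<subseteq> torus_proj M' a" if ab: "b - a \<in> M'" for a b
    unfolding torus_proj_def
  proof clarify
    fix u assume "u \<in> M'"
    then show "b + u \<in> (+) a ` M'"
      using add_M'[OF ab] by (intro image_eqI[of _ _ "b - a + u"]) auto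
  qed
  assume "y - x \<in> M'"
  then show "torus_proj M' x = torus_proj M' y"
    using sub[of y x] sub[of x y] uminus_M'[of "y - x"] by auto
qed

lemma compact_torus: "compact_space (torus M')"
proof -
  obtain r where r: "\<And>x. \<exists>u\<in>M'. norm (x - u) \<le> r"
    using cocompact_M' by blast
  have "range (torus_proj M') \<subseteq> torus_proj M' ` cball 0 r"
  proof clarify
    fix x
    obtain u where u: "u \<in> M'" "norm (x - u) \<le> r"
      using r by blast
    then have "torus_proj M' x = torus_proj M' (x - u)"
      by (simp add: torus_proj_eq_iff uminus_M')
    then show "torus_proj M' x \<in> torus_proj M' ` cball 0 r"
      using u(2) by auto
  qed
  then have "topspace (torus M') = torus_proj M' ` cball 0 r"
    by (auto simp: topspace_torus)
  moreover have "compactin (torus M') (torus_proj M' ` cball 0 r)"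
    by (rule image_compactin[OF _ quotient_imp_continuous_map[OF quotient_map_torus_proj]]) simp
  ultimately show ?thesis
    by (simp add: compact_space_def)
qed

text \<open>A continuous map from a compact space to a Hausdorff space is closed, so injectivity is
  the point. It comes from \<open>theta_separates\<close>, because \<open>theta p\<close> depends
  only on the coset of \<open>p\<close> and every coset is represented.\<close>

lemma embedding_theta:
  fixes r :: "nat \<Rightarrow> 'v"
  assumes r: "\<And>i. i \<le> m \<Longrightarrow> r i \<in> P" and cover: "\<And>p. p \<in> P \<Longrightarrow> \<exists>i\<le>m. p - r i \<in> M'"
    and \<phi>: "\<And>x. \<phi> (torus_proj M' x) = (\<lambda>i. if i < m then theta (r (Suc i)) x - theta (r 0) x else 0)"
  shows "embedding_map (torus M') (Euclidean_space m) \<phi>"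
proof (rule injective_closed_imp_embedding_map)
  have "continuous_map euclidean euclideanreal (\<lambda>x. \<phi> (torus_proj M' x) i)" for i
    unfolding \<phi> using r by (auto intro!: continuous_intros continuous_theta)
  then have "continuous_map euclidean (Euclidean_space m) (\<phi> \<circ> torus_proj M')"
    by (simp add: Euclidean_space_def continuous_map_in_subtopology continuous_map_componentwise_UNIV \<phi>
        image_subset_iff)
  then have cont: "continuous_map (torus M') (Euclidean_space m) \<phi>"
    using continuous_compose_quotient_map quotient_map_torus_proj by blast
  show "closed_map (torus M') (Euclidean_space m) \<phi>"
    using continuous_imp_closed_map[OF cont compact_torus Hausdorff_Euclidean_space] by blast
  show "continuous_map (torus M') (Euclidean_space m) \<phi>"
    by (rule cont)
  show "inj_on \<phi> (topspace (torus M'))"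
    unfolding topspace_torus
  proof (rule inj_onI, clarify)
    fix x y assume eq: "\<phi> (torus_proj M' x) = \<phi> (torus_proj M' y)"
    \<comment> \<open>Only differences with the coordinate of \<open>r 0\<close> are visible, so
      values at \<open>x\<close> and \<open>y\<close> agree up to one common constant.\<close>
    define k where "k = theta (r 0) x - theta (r 0) y"
    have idx: "theta (r i) x - theta (r i) y = k" if "i \<le> m" for i
    proof (cases i)
      case (Suc j)
      then show ?thesis
        using fun_cong[OF eq, of j] that by (simp add: \<phi> k_def)
    qed (simp add: k_def)
    have "theta p x - theta p y = k" if p: "p \<in> P" for p
    proof -
      obtain i where i: "i \<le> m" "p - r i \<in> M'"
        using cover[OF p] by blast
      have "theta p = theta (r i)"
        using coset_dist_shift[OF i(2), of "_ + c - r i"] by (simp add: theta_def fun_eq_iff)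
      then show ?thesis
        using idx[OF i(1)] by simp
    qed
    then show "torus_proj M' x = torus_proj M' y"
      using theta_separates by (simp add: torus_proj_eq_iff)
  qed
qed

text \<open>Every coset of \<open>M'\<close> in \<open>P\<close> meets the bounded set
  \<open>voronoi M'\<close>, and bounded parts of \<open>P\<close> are finite. A coset may be listed
  several times.\<close>

lemma ex_representatives:
  obtains m and r :: "nat \<Rightarrow> 'v"
  where "\<And>i. i \<le> m \<Longrightarrow> r i \<in> P" "\<And>p. p \<in> P \<Longrightarrow> \<exists>i\<le>m. p - r i \<in> M'"
proof -
  obtain \<rho> where \<rho>: "\<rho> \<ge> 0" "\<And>z. z \<in> voronoi M' \<Longrightarrow> q z \<le> \<rho>"
    using voronoi_M'_bounded by blast
  let ?R = "{p \<in> P. q p \<le> \<rho>}"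
  obtain n and f :: "nat \<Rightarrow> 'v" where f: "?R = f ` {i. i < n}"
    using finite_imp_nat_seg_image_inj_on[OF finite_sublevel_P[of \<rho>]] by blast
  \<comment> \<open>The enumeration is thus nonempty and has a last index \<open>m\<close>.\<close>
  have "0 \<in> ?R"
    using zero_P \<rho>(1) by (simp add: Q_simps)
  then obtain m where n: "n = Suc m"
    using f by (cases n) auto
  show thesis
  proof (rule that[of m f])
    show "f i \<in> P" if "i \<le> m" for i
      using f that n by auto
    fix p assume p: "p \<in> P"
    obtain u where u: "u \<in> M'" "p - u \<in> voronoi M'"
      using ex_voronoi_M' by blast
    then have "p - u \<in> ?R"
      using p diff_P M'_subset_P \<rho>(2) by blast
    then obtain i where "i < n" "p - u = f i"
      unfolding f by blast
    then have "i \<le> m" "p - f i = u"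
      using n by (simp_all add: algebra_simps)
    then show "\<exists>i\<le>m. p - f i \<in> M'"
      using u(1) by blast
  qed
qed

end


subsection \<open>Descent data\<close>

lemma real_dual_pairing_additive:
  assumes "real_dual_pairing pair"
  shows "Modules.additive (\<lambda>u. pair u x)"
  using assms by (auto simp: real_dual_pairing_def bij_betw_def)

lemma pair_smul:
  fixes smul :: "int \<Rightarrow> 'm::ab_group_add \<Rightarrow> 'm"
  assumes "module smul" "real_dual_pairing pair"
  shows "pair (smul k w) x = of_int k * pair w x"
proof -
  interpret module smul
    by fact
  interpret additive "\<lambda>u. pair u x"
    by (rule real_dual_pairing_additive) fact
  show ?thesis
    by (induction k rule: int_induct[of _ 0])
      (simp_all add: zero add diff scale_left_distrib scale_left_diff_distrib algebra_simps)
qed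

text \<open>\<open>X\<close> is a dual basis: each coordinate function of \<open>M\<close> is
  additive, hence pairing with a vector, and bounded integer coordinates leave finitely many
  elements.\<close>

lemma finite_bounded_pairing:
  fixes smul :: "int \<Rightarrow> 'm::ab_group_add \<Rightarrow> 'm" and pair :: "'m \<Rightarrow> 'v::euclidean_space \<Rightarrow> real"
  assumes "free_int_module smul n" "real_dual_pairing pair"
  obtains X where "finite X" "\<And>K. finite {w. \<forall>x\<in>X. \<bar>pair w x\<bar> \<le> K}"
proof -
  interpret module smul
    using assms(1) by (simp add: free_int_module_def)
  obtain B where B: "finite B" "independent B" "span B = UNIV"
    using assms(1) by (auto simp: free_int_module_def)
  have "\<exists>x. \<forall>w. pair w x = of_int (representation B w b)" for b
  proof -
    have "Modules.additive (\<lambda>w. real_of_int (representation B w b))"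
      by unfold_locales (simp add: representation_add B)
    then have "(\<lambda>w. real_of_int (representation B w b)) \<in> range (\<lambda>x w. pair w x)"
      using assms(2) by (simp add: real_dual_pairing_def bij_betw_def)
    then show ?thesis
      by (metis imageE)
  qed
  then obtain x where x: "\<And>b w. pair w (x b) = of_int (representation B w b)"
    by metis
  have "finite {w. \<forall>y\<in>x ` B. \<bar>pair w y\<bar> \<le> K}" for K
  proof (rule finite_subset)
    let ?F = "PiE B (\<lambda>_. {- \<lceil>K\<rceil>..\<lceil>K\<rceil>})"
    show "finite ((\<lambda>f. \<Sum>b\<in>B. smul (f b) b) ` ?F)"
      using B(1) by (intro finite_imageI finite_PiE) auto
    show "{w. \<forall>y\<in>x ` B. \<bar>pair w y\<bar> \<le> K} \<subseteq> (\<lambda>f. \<Sum>b\<in>B. smul (f b) b) ` ?F"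
    proof clarify
      fix w assume w: "\<forall>y\<in>x ` B. \<bar>pair w y\<bar> \<le> K"
      have "representation B w b \<in> {- \<lceil>K\<rceil>..\<lceil>K\<rceil>}" if "b \<in> B" for b
      proof -
        have "\<bar>real_of_int (representation B w b)\<bar> \<le> K"
          using w that x by auto
        then show ?thesis
          by (simp add: abs_le_iff) linarith
      qed
      then have "restrict (representation B w) B \<in> ?F"
        by auto
      moreover have "w = (\<Sum>b\<in>B. smul (restrict (representation B w) B b) b)"
        using sum_representation_eq[OF B(2) _ B(1) order.refl, of w] B(3) by simp
      ultimately show "w \<in> (\<lambda>f. \<Sum>b\<in>B. smul (f b) b) ` ?F"
        by blast
    qed
  qed
  then show thesis
    using that[of "x ` B"] B(1) by blast
qed

text \<open>\<open>T\<close> expresses \<open>Q\<close> through the inner product. Definiteness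
  makes it injective, hence surjective, and \<open>c\<close> is the preimage of the vector
  representing \<open>l\<close>.\<close>

lemma positive_definite_riesz:
  fixes Q :: "'v::euclidean_space \<Rightarrow> 'v \<Rightarrow> real"
  assumes Q: "bilinear Q" and pos: "\<And>x. x \<noteq> 0 \<Longrightarrow> Q x x > 0" and "linear l"
  obtains c where "\<And>x. l x = Q c x"
proof -
  define T where "T c = (\<Sum>b\<in>Basis. Q c b *\<^sub>R b)" for c
  have T: "T c \<bullet> x = Q c x" for c x
  proof -
    have "Q c x = Q c (\<Sum>b\<in>Basis. (x \<bullet> b) *\<^sub>R b)"
      by (simp add: euclidean_representation)
    also have "\<dots> = (\<Sum>b\<in>Basis. (x \<bullet> b) * Q c b)"
      using Q by (simp add: bilinear_def linear_sum linear_cmul)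
    finally show ?thesis
      by (simp add: T_def inner_sum_left inner_commute[of x] mult.commute)
  qed
  have "linear T"
    by (rule linearI)
      (simp_all add: T_def bilinear_ladd[OF Q] bilinear_lmul[OF Q] scaleR_left_distrib
        sum.distrib scaleR_sum_right)
  moreover have "inj T"
    unfolding linear_injective_0[OF \<open>linear T\<close>]
    using T pos by (metis inner_zero_left less_irrefl)
  ultimately have "surj T"
    by (rule linear_inj_imp_surj)
  then obtain c where c: "T c = (\<Sum>b\<in>Basis. l b *\<^sub>R b)"
    by (metis surjD)
  have "l x = Q c x" for x
  proof -
    have "l x = l (\<Sum>b\<in>Basis. (x \<bullet> b) *\<^sub>R b)"
      by (simp add: euclidean_representation)
    also have "\<dots> = (\<Sum>b\<in>Basis. (x \<bullet> b) * l b)"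
      using \<open>linear l\<close> by (simp add: linear_sum linear_cmul)
    also have "\<dots> = T c \<bullet> x"
      unfolding c by (simp add: inner_sum_left inner_commute[of x] mult.commute)
    finally show ?thesis
      by (simp add: T)
  qed
  then show thesis
    using that by blast
qed

lemma integer_span_subset:
  fixes B :: "'v::real_vector set"
  assumes "finite B" "B \<subseteq> G" "0 \<in> G" and diff: "\<And>x y. x \<in> G \<Longrightarrow> y \<in> G \<Longrightarrow> x - y \<in> G"
  shows "(\<Sum>b\<in>B. of_int (k b) *\<^sub>R b) \<in> G"
proof -
  have add: "x + y \<in> G" if "x \<in> G" "y \<in> G" for x y
    using diff[OF that(1) diff[OF assms(3) that(2)]] by simp
  have mult: "of_int j *\<^sub>R b \<in> G" if "b \<in> G" for b and j :: int
    by (induction j rule: int_induct[of _ 0])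
      (simp_all add: assms(3) that add diff scaleR_left_distrib scaleR_left_diff_distrib)
  show ?thesis
    using assms(1,2) by (induction B rule: finite_induct) (simp_all add: assms(3) add mult)
qed

text \<open>Rounding down the coordinates leaves coefficients in the unit interval.\<close>

lemma full_lattice_cocompact:
  fixes B :: "'v::euclidean_space set"
  assumes "independent B" "span B = UNIV"
  shows "\<exists>k. norm (x - (\<Sum>b\<in>B. of_int (k b) *\<^sub>R b)) \<le> (\<Sum>b\<in>B. norm b)"
proof -
  have "finite B"
    using assms(1) independent_imp_finite by blast
  let ?a = "representation B x"
  have "x = (\<Sum>b\<in>B. ?a b *\<^sub>R b)"
    using real_vector.sum_representation_eq[OF assms(1) _ \<open>finite B\<close> order.refl, of x] assms(2) by simp
  then have "x - (\<Sum>b\<in>B. of_int \<lfloor>?a b\<rfloor> *\<^sub>R b) = (\<Sum>b\<in>B. frac (?a b) *\<^sub>R b)"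
    by (simp add: frac_def scaleR_left_diff_distrib sum_subtractf)
  also have "norm \<dots> \<le> (\<Sum>b\<in>B. norm b)"
  proof (rule sum_norm_le)
    fix b
    show "norm (frac (?a b) *\<^sub>R b) \<le> norm b"
      using frac_lt_1[of "?a b"] frac_ge_0[of "?a b"] mult_right_mono[of "frac (?a b)" 1 "norm b"] by simp
  qed
  finally show ?thesis
    by (intro exI[of _ "\<lambda>b. \<lfloor>?a b\<rfloor>"])
qed

theorem theorem1p2:
  fixes smul :: "int \<Rightarrow> 'm::ab_group_add \<Rightarrow> 'm"
    and pair :: "'m \<Rightarrow> 'v::euclidean_space \<Rightarrow> real"
    and M' :: "'v set"
    and lam :: "'v \<Rightarrow> 'm"
    and gam :: "'v \<Rightarrow> real"
    and n :: nat
    and d :: int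
  assumes "free_int_module smul n"
    and "n \<ge> 1"
    and "real_dual_pairing pair"
    and "full_lattice M'"
    and "tropical_abelian_variety pair M'"
    and "positive_line_bundle pair M' lam gam"
    and "d \<ge> max 3 (2 * fact (n - 1))"
  shows "admits_faithful_embedding pair M' (\<lambda>u. smul d (lam u)) (\<lambda>u. of_int d * gam u)"
proof -

  \<comment> \<open>The lattice basis and the form of the polarization\<close>
  have smul: "pair (smul k w) x = of_int k * pair w x" for k w x
    using assms(1,3) pair_smul by (auto simp: free_int_module_def)
  have linear_pair: "linear (pair w)" for w
    using assms(3) by (simp add: real_dual_pairing_def)
  have additive_pair: "Modules.additive (\<lambda>w. pair w x)" for x
    by (rule real_dual_pairing_additive) fact
  obtain B where B: "independent B" "span B = UNIV"
    and M': "M' = {\<Sum>b\<in>B. of_int (k b) *\<^sub>R b | k :: 'v \<Rightarrow> int. True}"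
    using assms(4) by (auto simp: full_lattice_def)
  have fin: "finite B"
    using B(1) independent_imp_finite by blast
  have zero_M': "0 \<in> M'"
    unfolding M' by (rule CollectI, rule exI[of _ "\<lambda>_. 0"]) simp
  have diff_M': "u - v \<in> M'" if uv: "u \<in> M'" "v \<in> M'" for u v
  proof -
    obtain k l :: "'v \<Rightarrow> int" where "u = (\<Sum>b\<in>B. of_int (k b) *\<^sub>R b)" "v = (\<Sum>b\<in>B. of_int (l b) *\<^sub>R b)"
      using uv by (auto simp: M')
    then have "u - v = (\<Sum>b\<in>B. of_int (k b - l b) *\<^sub>R b)"
      by (simp add: sum_subtractf scaleR_left_diff_distrib)
    then show ?thesis
      unfolding M' by (intro CollectI exI[of _ "\<lambda>b. k b - l b"]) simp
  qed
  have B_subset: "B \<subseteq> M'"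
  proof
    fix b assume "b \<in> B"
    then have "b = (\<Sum>b'\<in>B. of_int (if b' = b then 1 else 0) *\<^sub>R b')"
      using fin by (simp add: if_distrib[of of_int] if_distrib[of "\<lambda>c. c *\<^sub>R _"] cong: if_cong)
    then show "b \<in> M'"
      unfolding M' by (intro CollectI exI[of _ "\<lambda>b'. if b' = b then 1 else 0"]) simp
  qed
  have M'_induct: "M' \<subseteq> G" if "B \<subseteq> G" "0 \<in> G" "\<And>x y. x \<in> G \<Longrightarrow> y \<in> G \<Longrightarrow> x - y \<in> G" for G
    using integer_span_subset[OF fin that] by (auto simp: M')
  obtain Q where Q: "bilinear Q" "\<And>x y. Q x y = Q y x" "\<And>x. x \<noteq> 0 \<Longrightarrow> Q x x > 0"
    and Q_M': "\<And>u v. u \<in> M' \<Longrightarrow> v \<in> M' \<Longrightarrow> Q u v = pair (lam u) v"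
    using assms(6) unfolding positive_line_bundle_def polarization_def by auto
  have gam: "gam (u + v) = gam u + gam v + Q v u" if "u \<in> M'" "v \<in> M'" for u v
    using assms(6) Q_M'[OF that(2,1)] that
    by (fastforce simp: positive_line_bundle_def tropical_descent_datum_def)
  have linear_Q: "linear (Q p)" "linear (\<lambda>x. Q x p)" for p
    using Q(1) by (simp_all add: bilinear_def)
  have slope: "pair (lam u) x = Q u x" if "u \<in> M'" for u x
  proof (rule linear_eq_on_span[OF linear_pair linear_Q(1)])
    show "pair (lam u) b = Q u b" if "b \<in> B" for b
      using Q_M'[OF \<open>u \<in> M'\<close>] that B_subset by auto
  qed (simp add: B(2))
  have d: "d \<ge> 3"
    using assms(7) by simp

  \<comment> \<open>Completing the square in the descent datum\<close>
  define g where "g u = gam u - Q u u / 2" for u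
  have g_add: "g (u + v) = g u + g v" if "u \<in> M'" "v \<in> M'" for u v
    using gam[OF that] Q(2)[of u v]
    by (simp add: g_def bilinear_ladd[OF Q(1)] bilinear_radd[OF Q(1)] field_simps)
  have g_diff: "g (u - v) = g u - g v" if "u \<in> M'" "v \<in> M'" for u v
    using g_add[OF diff_M'[OF that] that(2)] by simp
  \<comment> \<open>Subtracting half the quadratic form leaves an additive map \<open>g\<close> on
    \<open>M'\<close>. It extends to a linear form, and the vector representing that form under
    \<open>Q\<close> is the translation \<open>c\<close>.\<close>
  obtain l where l: "linear l" "\<And>b. b \<in> B \<Longrightarrow> l b = g b"
    using linear_independent_extend[OF B(1), of g] by blast
  have "M' \<subseteq> {u \<in> M'. l u = g u}"
  proof (rule M'_induct)
    show "0 \<in> {u \<in> M'. l u = g u}"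
      using zero_M' g_add[of 0 0] linear_0[OF l(1)] by simp
  qed (use B_subset l(2) diff_M' g_diff linear_diff[OF l(1)] in auto)
  moreover obtain c where "\<And>x. l x = Q c x"
    using positive_definite_riesz[OF Q(1,3) l(1)] by blast
  ultimately have gam_eq: "gam u = Q u u / 2 + Q u c" if "u \<in> M'" for u
    using that Q(2)[of c u] by (auto simp: g_def)

  \<comment> \<open>The lattice corresponding to \<open>M\<close> under \<open>d Q\<close>\<close>
  define P where "P = {p. \<exists>w. \<forall>x. pair w x = of_int d * Q p x}"
  have ortho: "z = 0" if "\<And>u. u \<in> M' \<Longrightarrow> Q u z = 0" for z
  proof -
    have "Q z z = 0"
    proof (rule linear_eq_0_on_span[OF linear_Q(2)])
      show "Q b z = 0" if "b \<in> B" for b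
        using \<open>\<And>u. u \<in> M' \<Longrightarrow> Q u z = 0\<close> that B_subset by blast
    qed (simp add: B(2))
    then show ?thesis
      using Q(3) by force
  qed
  \<comment> \<open>The slope map \<open>w\<close> embeds \<open>P\<close> into \<open>M\<close>; a
    bound on \<open>Q p p\<close> bounds the pairings of \<open>w p\<close> with the finite set
    \<open>X\<close>.\<close>
  have sublevel: "finite {p \<in> P. Q p p \<le> K}" for K
  proof -
    obtain X where X: "finite X" "\<And>K. finite {w. \<forall>x\<in>X. \<bar>pair w x\<bar> \<le> K}"
      using finite_bounded_pairing[OF assms(1,3)] by blast
    have "\<forall>p\<in>P. \<exists>w. \<forall>x. pair w x = of_int d * Q p x"
      by (simp add: P_def)
    then obtain w where w: "\<And>p x. p \<in> P \<Longrightarrow> pair (w p) x = of_int d * Q p x"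
      by metis
    have Q_nonneg: "Q x x \<ge> 0" for x
      using Q(3)[of x] linear_0[OF linear_Q(1)] by (cases "x = 0") force+
    have abs_Q: "\<bar>Q p x\<bar> \<le> Q p p + Q x x" for p x
      using Q_nonneg[of "p + x"] Q_nonneg[of "p - x"] Q_nonneg[of p] Q_nonneg[of x] Q(2)[of p x]
      by (simp add: bilinear_ladd[OF Q(1)] bilinear_radd[OF Q(1)] bilinear_lsub[OF Q(1)] bilinear_rsub[OF Q(1)])
    show ?thesis
    proof (rule finite_imageD)
      have "w ` {p \<in> P. Q p p \<le> K} \<subseteq> {w. \<forall>x\<in>X. \<bar>pair w x\<bar> \<le> of_int d * (K + (\<Sum>x\<in>X. Q x x))}"
      proof clarify
        fix p x assume p: "p \<in> P" "Q p p \<le> K" and x: "x \<in> X"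
        have "Q x x \<le> (\<Sum>x\<in>X. Q x x)"
          using X(1) x Q_nonneg by (intro member_le_sum) auto
        then have "\<bar>Q p x\<bar> \<le> K + (\<Sum>x\<in>X. Q x x)"
          using abs_Q[of p x] p(2) by simp
        then show "\<bar>pair (w p) x\<bar> \<le> of_int d * (K + (\<Sum>x\<in>X. Q x x))"
          using d by (simp add: w[OF p(1)] abs_mult)
      qed
      then show "finite (w ` {p \<in> P. Q p p \<le> K})"
        using X(2) finite_subset by blast
      show "inj_on w {p \<in> P. Q p p \<le> K}"
      proof (rule inj_onI)
        fix p r assume "p \<in> {p \<in> P. Q p p \<le> K}" "r \<in> {p \<in> P. Q p p \<le> K}" "w p = w r"
        then have "Q p x = Q r x" for x
          using w[of p x] w[of r x] d by simp
        then have "Q (p - r) (p - r) = 0"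
          by (simp add: bilinear_lsub[OF Q(1)])
        then show "p = r"
          using Q(3)[of "p - r"] by force
      qed
    qed
  qed
  interpret polarized_lattice pair M' P Q c "of_int d"
  proof
    show "\<exists>r. \<forall>x. \<exists>u\<in>M'. norm (x - u) \<le> r"
      using full_lattice_cocompact[OF B] unfolding M' by blast
    show "M' \<subseteq> P"
    proof
      fix u assume "u \<in> M'"
      then have "pair (smul d (lam u)) x = of_int d * Q u x" for x
        by (simp add: smul slope)
      then show "u \<in> P"
        unfolding P_def by blast
    qed
    \<comment> \<open>The factor \<open>d\<close> cancels, and the slope is
      \<open>lam u\<close>.\<close>
    show "(1 / of_int d) *\<^sub>R u \<in> P" if "u \<in> M'" for u
      unfolding P_def using slope[OF that] d by (auto simp: bilinear_lmul[OF Q(1)])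
    show "p - r \<in> P" if "p \<in> P" "r \<in> P" for p r
    proof -
      obtain v w where "\<forall>x. pair v x = of_int d * Q p x" "\<forall>x. pair w x = of_int d * Q r x"
        using \<open>p \<in> P\<close> \<open>r \<in> P\<close> by (auto simp: P_def)
      then show ?thesis
        unfolding P_def
        by (intro CollectI exI[of _ "v - w"])
          (simp add: additive.diff[OF additive_pair] bilinear_lsub[OF Q(1)] right_diff_distrib)
    qed
    show "\<exists>w. \<forall>x. pair w x = Q u x" if "u \<in> M'" for u
      using slope[OF that] by blast
    show "\<exists>w. \<forall>x. pair w x = of_int d * Q p x" if "p \<in> P" for p
      using that by (simp add: P_def)
    show "\<exists>p\<in>P. \<forall>x. pair w x = of_int d * Q p x" for w
    proof -
      have "linear (\<lambda>x. pair w x / of_int d)"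
        by (rule linearI) (simp_all add: linear_add[OF linear_pair] linear_cmul[OF linear_pair] add_divide_distrib)
      then obtain p where "\<And>x. pair w x / of_int d = Q p x"
        using positive_definite_riesz[OF Q(1,3)] by blast
      then have "\<forall>x. pair w x = of_int d * Q p x"
        using d by (simp add: field_simps)
      then show ?thesis
        unfolding P_def by blast
    qed
  qed (use Q d zero_M' diff_M' sublevel ortho in auto)

  \<comment> \<open>The sections of the multiple bundle and their map\<close>
  obtain m and r :: "nat \<Rightarrow> 'v"
    where r: "\<And>i. i \<le> m \<Longrightarrow> r i \<in> P" "\<And>p. p \<in> P \<Longrightarrow> \<exists>i\<le>m. p - r i \<in> M'"
    using ex_representatives by blast
  define s where "s i x = ereal (theta (r i) x)" for i x
  have s: "\<forall>i\<le>m. s i \<in> theta_functions pair M' (\<lambda>u. smul d (lam u)) (\<lambda>u. of_int d * gam u) - {\<lambda>_. \<infinity>}"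
  proof (intro allI impI)
    fix i assume i: "i \<le> m"
    have "regular_function pair (s i)"
      unfolding s_def using regular_theta[OF r(1)[OF i]] .
    moreover have "s i (x + u) = s i x - ereal (pair (smul d (lam u)) x) - ereal (of_int d * gam u)"
      if "u \<in> M'" for x u
      by (simp add: s_def theta_shift[OF that] smul slope[OF that] gam_eq[OF that])
    moreover have "s i \<noteq> (\<lambda>_. \<infinity>)"
      by (auto simp: s_def fun_eq_iff)
    ultimately show "s i \<in> theta_functions pair M' (\<lambda>u. smul d (lam u)) (\<lambda>u. of_int d * gam u) - {\<lambda>_. \<infinity>}"
      by (simp add: theta_functions_def)
  qed
  have \<phi>: "theta_map M' m s (torus_proj M' x) =
      (\<lambda>i. if i < m then theta (r (Suc i)) x - theta (r 0) x else 0)" for x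
    using theta_map_torus_proj[OF assms(4) s] by (simp add: s_def cong: if_cong)
  have "faithful_embedding pair M' m (theta_map M' m s)"
    unfolding faithful_embedding_def
    using unimodular_theta[OF r] embedding_theta[OF r \<phi>] by (simp add: \<phi>)
  then show ?thesis
    unfolding admits_faithful_embedding_def using s by blast
qed

end
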